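(* Let $(X,d)$ be a (nonempty) compact metric space, $\alpha:X\to X$ a continuous map that is a local homeomorphism on $X_\alpha$ (i.e. $\alpha:X_\alpha\to X_\alpha$ is a local homeomorphism), and $A:C(X)\to C(X)$ an $X_\alpha$-compatible transfer operator for $(X,\alpha)$ with cocycle $\rho$ on $X_\alpha$. If $\alpha$ possesses Property $( * )$ and $\rho$ is strictly positive on $X_\alpha$, then for each strictly positive continuous extension of $\rho$ onto $X$ (again denoted $\rho$) and each $\psi\in C(X,\mathbb R)$ we have $$\lambda(\psi)=P(\alpha,\psi+\ln\rho).$$
   Context: A transfer operator for $(X,\alpha)$ is a positive linear operator $A:C(X)\to C(X)$ with $A((f\circ\alpha)g)=f\,Ag$ for all $f,g\in C(X)$. For $\psi\in C(X,\mathbb R)$ (real continuous functions), $A_\psi f:=A(e^\psi f)$ and $\lambda(\psi):=\lim_{n\to\infty}\frac1n\ln\|A_\psi^n\|$. $M_\alpha(X)$ is the set of Borel $\alpha$-invariant probability measures on $X$. A point $x\in X$ is essential if every neighborhood $V$ of $x$ satisfies $\mu(V)>0$ for some $\mu\in M_\alpha(X)$; $X_\alpha$ is the (closed) set of essential points, and $\alpha(X_\alpha)=X_\alpha$. For $S\subset X_\alpha$ put $\tilde\alpha^{-n}(S):=\alpha^{-n}(S)\cap X_\alpha$. A local homeomorphism is a map such that every point has an open neighborhood mapped homeomorphically onto an open set; on $X_\alpha$ this makes all the sets $\tilde\alpha^{-1}(x)$ finite with uniformly bounded cardinality. Compatibility and cocycle: for $x\in X$ let $\nu_x$ be the regular Borel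 measure (possibly $0$) with $\int f\,d\nu_x=[Af](x)$ for $f\in C(X)$; its support lies in $\alpha^{-1}(x)$. $A$ is $X_\alpha$-compatible if for every $f\in C(X_\alpha)$ the function $x\mapsto\int_{X_\alpha}f\,d\nu_x$ is continuous on $X_\alpha$; then $[A_{X_\alpha}f](x):=\int_{X_\alpha}f\,d\nu_x$ defines a transfer operator on $C(X_\alpha)$. It has the form $[A_{X_\alpha}f](x)=\sum_{y\in\tilde\alpha^{-1}(x)}\rho(y)f(y)$, where $\rho(y)=\nu_{\alpha(y)}(\{y\})\ge0$, $y\in X_\alpha$; $\rho$ is called the cocycle. (When $\alpha$ is a local homeomorphism on $X_\alpha$, $\rho$ is continuous on $X_\alpha$.) Put $d_n(x,y):=\max_{0\le i\le n-1}d(\alpha^i(x),\alpha^i(y))$. A set $E\subset X$ is $(n,\varepsilon)$-spanning if for every $x\in X$ there is $y\in E$ with $d_n(x,y)<\varepsilon$; $E\subset X_\alpha$ is $(n,\varepsilon)$-spanning for $X_\alpha$ if for every $x\in X_\alpha$ there is $y\in E$ with $d_n(x,y)<\varepsilon$. Property $( * )$: for each $n\in\mathbb N$ and $\varepsilon>0$ there is a finite set $F(n,\varepsilon)\subset X_\alpha$ such that $\tilde\alpha^{-n}(F(n,\varepsilon))$ is $(n,\varepsilon)$-spanning for $X_\alpha$ and (for each $\varepsilon>0$) $\lim_{n\to\infty}|F(n,\varepsilon)|^{1/n}=1$. Topological pressure (for positive $a\in C(X)$): $$P(\alpha,\ln a):=\ln\lim_{\varepsilon\to0}\limsup_{n\to\infty}\inf\Bigl\{\Bigl(\sum_{y\in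 E}\prod_{i=0}^{n-1}a(\alpha^i(y))\Bigr)^{1/n}: E\text{ is }(n,\varepsilon)\text{-spanning}\Bigr\}.$$ *)

theory Defs
  imports "HOL-Analysis.Analysis" "HOL-Probability.Probability_Measure"
begin

text \<open>
  The space \<open>X\<close> is a type, with the metric given by the type class.  Nonemptiness is automatic, and
  no generality is lost by the subclass relation to \<open>polish_space\<close> proved below.
\<close>

class compact_metric_space = metric_space +
  assumes compact_carrier: "compact UNIV"

instance compact_metric_space \<subseteq> polish_space
proof
  show "convergent X" if "Cauchy X" for X :: "nat \<Rightarrow> 'a"
  proof -
    have "complete (UNIV :: 'a set)"
      using compact_carrier by (rule compact_imp_complete)
    with that show ?thesis
      unfolding complete_def convergent_def by blast
  qed
  show "\<exists>B::'a set set. countable B \<and> open = generate_topology B"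
  proof -
    have "\<exists>K. finite K \<and> (UNIV::'a set) \<subseteq> (\<Union>x\<in>K. ball x (1 / real (Suc n)))" for n
    proof -
      have "\<forall>e>0. \<exists>K. finite K \<and> (UNIV::'a set) \<subseteq> (\<Union>x\<in>K. ball x e)"
        using compact_carrier unfolding compact_eq_totally_bounded by blast
      then show ?thesis
        by simp
    qed
    then obtain K where fin: "finite (K n)"
      and cov: "(UNIV::'a set) \<subseteq> (\<Union>x\<in>K n. ball x (1 / real (Suc n)))" for n
      by metis
    define B where "B = (\<Union>n. (\<lambda>x. ball x (1 / real (Suc n))) ` K n)"
    have "countable B"
      unfolding B_def using fin by (intro countable_UN countable_image) (auto intro: countable_finite)
    moreover have "topological_basis B"
    proof (rule topological_basisI)
      show "open U" if "U \<in> B" for U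
        using that by (auto simp: B_def)
      fix S :: "'a set" and x
      assume "open S" "x \<in> S"
      then obtain e where e: "e > 0" "ball x e \<subseteq> S"
        using open_contains_ball by blast
      obtain n where n: "1 / real (Suc n) < e / 2"
        using e reals_Archimedean[of "e / 2"] by (auto simp: inverse_eq_divide)
      obtain y where y: "y \<in> K n" "x \<in> ball y (1 / real (Suc n))"
        using cov[of n] by blast
      have "ball y (1 / real (Suc n)) \<subseteq> ball x e"
      proof
        fix z assume "z \<in> ball y (1 / real (Suc n))"
        then have "dist y z < 1 / real (Suc n)"
          by (simp only: mem_ball)
        moreover have "dist y x < 1 / real (Suc n)"
          using y(2) by (simp only: mem_ball)
        ultimately have "dist x z < e"
          using n dist_triangle3[of x z y] by linarith
        then show "z \<in> ball x e"
          by (simp only: mem_ball)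
      qed
      then have "x \<in> ball y (1 / real (Suc n)) \<and> ball y (1 / real (Suc n)) \<subseteq> S"
        using y(2) e(2) by (meson subset_trans)
      moreover have "ball y (1 / real (Suc n)) \<in> B"
        unfolding B_def using y(1) by blast
      ultimately show "\<exists>U\<in>B. x \<in> U \<and> U \<subseteq> S"
        by (rule bexI)
    qed
    ultimately show ?thesis
      using topological_basis_imp_subbasis by blast
  qed
qed

text \<open>
  \<open>C(X)\<close> is the Banach space \<open>'a \<Rightarrow>\<^sub>C complex\<close>; on a compact space every continuous function
  is bounded, so that \<open>Bcontfun\<close> embeds all continuous functions.
\<close>

lemma apply_Bcontfun_compact:
  fixes f :: "'a::compact_metric_space \<Rightarrow> 'b::metric_space"
  assumes "continuous_on UNIV f"
  shows "apply_bcontfun (Bcontfun f) = f"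
proof -
  have "bounded (range f)"
    using compact_continuous_image[OF assms compact_carrier] by (rule compact_imp_bounded)
  with assms show ?thesis
    by (intro Bcontfun_inverse) (simp add: bcontfun_def)
qed

definition transfer_operator ::
    "('a::compact_metric_space \<Rightarrow> 'a) \<Rightarrow> (('a \<Rightarrow>\<^sub>C complex) \<Rightarrow> ('a \<Rightarrow>\<^sub>C complex)) \<Rightarrow> bool" where
  "transfer_operator \<alpha> A \<longleftrightarrow>
     (\<forall>f g. A (f + g) = A f + A g) \<and>
     (\<forall>c f. A (Bcontfun (\<lambda>x. c * apply_bcontfun f x)) =
            Bcontfun (\<lambda>x. c * apply_bcontfun (A f) x)) \<and>
     (\<forall>f. (\<forall>x. apply_bcontfun f x \<in> \<real>\<^sub>\<ge>\<^sub>0) \<longrightarrow> (\<forall>x. apply_bcontfun (A f) x \<in> \<real>\<^sub>\<ge>\<^sub>0)) \<and>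
     (\<forall>f g. A (Bcontfun (\<lambda>x. apply_bcontfun f (\<alpha> x) * apply_bcontfun g x)) =
            Bcontfun (\<lambda>x. apply_bcontfun f x * apply_bcontfun (A g) x))"

definition weighted_operator ::
    "(('a::compact_metric_space \<Rightarrow>\<^sub>C complex) \<Rightarrow> ('a \<Rightarrow>\<^sub>C complex)) \<Rightarrow> ('a \<Rightarrow>\<^sub>C real) \<Rightarrow>
     ('a \<Rightarrow>\<^sub>C complex) \<Rightarrow> ('a \<Rightarrow>\<^sub>C complex)" where
  "weighted_operator A \<psi> f =
     A (Bcontfun (\<lambda>x. complex_of_real (exp (apply_bcontfun \<psi> x)) * apply_bcontfun f x))"

text \<open>
  The real logarithm satisfies \<open>ln 0 = 0\<close>; both the spectral potential and the pressure need the
  extended one, with values \<open>-\<infinity>\<close> at \<open>0\<close> and \<open>\<infinity>\<close> at \<open>\<infinity>\<close>.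
\<close>

definition ext_ln :: "ereal \<Rightarrow> ereal" where
  "ext_ln x = (if x = \<infinity> then \<infinity> else if x \<le> 0 then - \<infinity> else ereal (ln (real_of_ereal x)))"

definition spectral_potential ::
    "(('a::compact_metric_space \<Rightarrow>\<^sub>C complex) \<Rightarrow> ('a \<Rightarrow>\<^sub>C complex)) \<Rightarrow> ('a \<Rightarrow>\<^sub>C real) \<Rightarrow> ereal" where
  "spectral_potential A \<psi> =
     lim (\<lambda>n. ereal (1 / real n) * ext_ln (ereal (onorm (weighted_operator A \<psi> ^^ n))))"

definition invariant_measures :: "('a::compact_metric_space \<Rightarrow> 'a) \<Rightarrow> 'a measure set" where
  "invariant_measures \<alpha> = {\<mu>. sets \<mu> = sets borel \<and> prob_space \<mu> \<and> distr \<mu> borel \<alpha> = \<mu>}"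

definition essential_points :: "('a::compact_metric_space \<Rightarrow> 'a) \<Rightarrow> 'a set" where
  "essential_points \<alpha> =
     {x. \<forall>V. open V \<and> x \<in> V \<longrightarrow> (\<exists>\<mu>\<in>invariant_measures \<alpha>. measure \<mu> V > 0)}"

definition local_homeomorphism ::
    "'a::topological_space set \<Rightarrow> 'b::topological_space set \<Rightarrow> ('a \<Rightarrow> 'b) \<Rightarrow> bool" where
  "local_homeomorphism S T f \<longleftrightarrow>
     (\<forall>x\<in>S. \<exists>U V g. openin (top_of_set S) U \<and> x \<in> U \<and> openin (top_of_set T) V \<and>
                     homeomorphism U V f g)"

definition regular_borel_measure :: "'a::topological_space measure \<Rightarrow> bool" where
  "regular_borel_measure M \<longleftrightarrow> sets M = sets borel \<and> finite_measure M \<and>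
     (\<forall>B\<in>sets borel. emeasure M B = (SUP K\<in>{K. K \<subseteq> B \<and> compact K}. emeasure M K) \<and>
                      emeasure M B = (INF U\<in>{U. B \<subseteq> U \<and> open U}. emeasure M U))"

text \<open>
  The measure \<open>\<nu>\<^sub>x\<close> representing the positive functional \<open>f \<mapsto> [Af](x)\<close>; it exists and is unique by
  the Riesz representation theorem.
\<close>

definition fibre_measure ::
    "(('a::compact_metric_space \<Rightarrow>\<^sub>C complex) \<Rightarrow> ('a \<Rightarrow>\<^sub>C complex)) \<Rightarrow> 'a \<Rightarrow> 'a measure" where
  "fibre_measure A x =
     (THE M. regular_borel_measure M \<and>
             (\<forall>f. (LINT y|M. apply_bcontfun f y) = apply_bcontfun (A f) x))"

definition compatible_on ::
    "'a::compact_metric_space set \<Rightarrow> (('a \<Rightarrow>\<^sub>C complex) \<Rightarrow> ('a \<Rightarrow>\<^sub>C complex)) \<Rightarrow> bool" where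
  "compatible_on S A \<longleftrightarrow>
     (\<forall>f::'a \<Rightarrow> complex. continuous_on S f \<longrightarrow>
        continuous_on S (\<lambda>x. LINT y:S|fibre_measure A x. f y))"

text \<open>Only the values at essential points are meaningful as the cocycle of \<open>A\<close>.\<close>

definition cocycle ::
    "('a::compact_metric_space \<Rightarrow> 'a) \<Rightarrow> (('a \<Rightarrow>\<^sub>C complex) \<Rightarrow> ('a \<Rightarrow>\<^sub>C complex)) \<Rightarrow> 'a \<Rightarrow> real" where
  "cocycle \<alpha> A y = measure (fibre_measure A (\<alpha> y)) {y}"

text \<open>The maximum below is over a nonempty set only for \<open>n \<ge> 1\<close>.\<close>

definition dyn_dist :: "('a::metric_space \<Rightarrow> 'a) \<Rightarrow> nat \<Rightarrow> 'a \<Rightarrow> 'a \<Rightarrow> real" where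
  "dyn_dist \<alpha> n x y = Max ((\<lambda>i. dist ((\<alpha> ^^ i) x) ((\<alpha> ^^ i) y)) ` {..<n})"

definition spanning :: "('a::metric_space \<Rightarrow> 'a) \<Rightarrow> nat \<Rightarrow> real \<Rightarrow> 'a set \<Rightarrow> 'a set \<Rightarrow> bool" where
  "spanning \<alpha> n \<epsilon> S E \<longleftrightarrow> E \<subseteq> S \<and> (\<forall>x\<in>S. \<exists>y\<in>E. dyn_dist \<alpha> n x y < \<epsilon>)"

definition property_star :: "('a::compact_metric_space \<Rightarrow> 'a) \<Rightarrow> bool" where
  "property_star \<alpha> \<longleftrightarrow>
     (\<exists>F :: nat \<Rightarrow> real \<Rightarrow> 'a set.
        (\<forall>n\<ge>1. \<forall>\<epsilon>>0. finite (F n \<epsilon>) \<and> F n \<epsilon> \<subseteq> essential_points \<alpha> \<and>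
           spanning \<alpha> n \<epsilon> (essential_points \<alpha>) ((\<alpha> ^^ n) -` F n \<epsilon> \<inter> essential_points \<alpha>)) \<and>
        (\<forall>\<epsilon>>0. (\<lambda>n. real (card (F n \<epsilon>)) powr (1 / real n)) \<longlonglongrightarrow> 1))"

text \<open>
  Here \<open>\<phi>\<close> stands for \<open>ln a\<close> with \<open>a = exp \<circ> \<phi>\<close> positive and continuous.  The infimum is taken over
  finite spanning sets: since \<open>a\<close> is bounded away from \<open>0\<close>, the sum over an infinite set is \<open>\<infinity>\<close>,
  whereas \<open>sum\<close> would return \<open>0\<close>.
\<close>

definition top_pressure :: "('a::compact_metric_space \<Rightarrow> 'a) \<Rightarrow> ('a \<Rightarrow> real) \<Rightarrow> ereal" where
  "top_pressure \<alpha> \<phi> =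
     ext_ln (Lim (at_right 0) (\<lambda>\<epsilon>. limsup (\<lambda>n.
       INF E\<in>{E. finite E \<and> spanning \<alpha> n \<epsilon> UNIV E}.
         ereal ((\<Sum>y\<in>E. \<Prod>i<n. exp (\<phi> ((\<alpha> ^^ i) y))) powr (1 / real n)))))"

end

theory Submission
  imports Defs
begin

text \<open>
  Write \<open>Y\<close> for the set of essential points, \<open>B\<close> for the weighted operator, \<open>W\<^sub>n\<close> for the product of
  \<open>e\<^sup>\<psi>\<rho>\<close> along an orbit of length \<open>n\<close> and \<open>h\<^sub>n x\<close> for the sum of \<open>W\<^sub>n\<close> over the points of \<open>Y\<close> that
  \<open>\<alpha>\<^sup>n\<close> maps to \<open>x\<close>.  By Krylov--Bogolyubov, a continuous function \<open>f\<close> vanishing on \<open>Y\<close> has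
  Birkhoff averages tending to \<open>0\<close> uniformly on \<open>X\<close>, so that multiplying a weight by \<open>exp (- t * f)\<close> does not
  change exponential growth rates, while for large \<open>t\<close> it makes everything away from \<open>Y\<close> negligible.

  For the operator, \<open>B\<^sup>m\<close> applied to cutoffs decreasing to the indicator of \<open>Y\<close> decreases to
  \<open>h\<^sub>m\<close>; splitting off \<open>m\<close> steps of an orbit that starts near \<open>Y\<close> and one step elsewhere
  bounds the exponential growth rate of \<open>\<parallel>B\<^sup>n\<parallel>\<close> by \<open>ln (sup h\<^sub>m) / m\<close> for every \<open>m\<close>.  Since the fibres of
  \<open>\<alpha>\<close> on \<open>Y\<close> are uniformly separated, \<open>h\<^sub>m\<close> is bounded by sums of \<open>W\<^sub>m\<close> over spanning sets,
  and the potential is at most the pressure.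

  For the pressure, Property \<open>(*)\<close> gives spanning sets of \<open>Y\<close> whose \<open>W\<^sub>m\<close>-sum is at most
  \<open>|F(m,\<epsilon>)| sup h\<^sub>m \<le> |F(m,\<epsilon>)| \<parallel>B\<^sup>m\<parallel>\<close>; concatenating them in time, with single steps through a
  finite net away from \<open>Y\<close>, yields spanning sets of \<open>X\<close> with the same growth rate.
\<close>

section \<open>Riesz representation on a compact metric space\<close>

text \<open>The sublevel sets form an increasing open cover, so by compactness one index serves all
  points. The pointwise limit may be discontinuous, as it is for cutoffs.\<close>

lemma dini_upper:
  fixes F :: "nat \<Rightarrow> 'a::compact_metric_space \<Rightarrow> real"
  assumes cont: "\<And>n. continuous_on UNIV (F n)"
    and dec: "\<And>x. decseq (\<lambda>n. F n x)"
    and lt: "\<And>x. \<exists>n. F n x < c"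
  shows "\<exists>n. \<forall>x. F n x < c"
proof -
  have op: "open {x. F n x < c}" for n
    by (intro open_Collect_less cont continuous_on_const)
  have sub: "UNIV \<subseteq> (\<Union>n\<in>UNIV. {x. F n x < c})"
    using lt by auto
  obtain N where N: "finite N" "UNIV \<subseteq> (\<Union>n\<in>N. {x. F n x < c})"
    by (rule compactE_image[OF compact_carrier op sub])
  have "F (Max N) x < c" for x
  proof -
    obtain n where "n \<in> N" "F n x < c" using N(2) by blast
    moreover have "F (Max N) x \<le> F n x"
      using dec N(1) \<open>n \<in> N\<close> by (auto simp: decseq_def)
    ultimately show ?thesis by linarith
  qed
  then show ?thesis by blast
qed

text \<open>Index \<open>0\<close> gives the constant \<open>1\<close>, the first term of the
  telescoping sums below. Since \<open>infdist\<close> to the empty set is \<open>0\<close>,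
  convergence to the indicator needs \<open>G\<close> nonempty.\<close>

definition cutoff :: "'a::metric_space set \<Rightarrow> nat \<Rightarrow> 'a \<Rightarrow> real" where
  "cutoff G j x = max 0 (1 - real j * infdist x G)"

lemma cutoff_nonneg [simp]: "0 \<le> cutoff G j x" and cutoff_le_1 [simp]: "cutoff G j x \<le> 1"
  by (auto simp: cutoff_def infdist_nonneg)

lemma continuous_on_cutoff [continuous_intros]: "continuous_on S (cutoff G j)"
  unfolding cutoff_def[abs_def] by (intro continuous_intros)

lemma cutoff_on: "x \<in> G \<Longrightarrow> cutoff G j x = 1"
  by (simp add: cutoff_def)

lemma cutoff_0 [simp]: "cutoff G 0 x = 1"
  by (simp add: cutoff_def)

lemma cutoff_decseq: "decseq (\<lambda>j. cutoff G j x)"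
  unfolding decseq_def cutoff_def
  by (intro allI impI max.mono order_refl diff_left_mono mult_right_mono infdist_nonneg) simp

lemma cutoff_tendsto:
  assumes "closed G" "G \<noteq> {}"
  shows "(\<lambda>j. cutoff G j x) \<longlonglongrightarrow> indicator G x"
proof (cases "x \<in> G")
  case True
  then show ?thesis by (simp add: cutoff_on)
next
  case False
  then have "infdist x G > 0"
    using assms by (simp add: infdist_pos_not_in_closed)
  then obtain N where N: "real N * infdist x G > 1"
    using reals_Archimedean3 by blast
  have "cutoff G j x = 0" if "j \<ge> N" for j
  proof -
    have "real N * infdist x G \<le> real j * infdist x G"
      using that by (intro mult_right_mono infdist_nonneg) auto
    then show ?thesis using N by (simp add: cutoff_def)
  qed
  then have "\<forall>\<^sub>F j in sequentially. cutoff G j x = indicator G x"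
    using False by (auto simp: eventually_sequentially)
  then show ?thesis by (rule tendsto_eventually)
qed

section \<open>Outer measure of a positive functional\<close>

locale positive_functional =
  fixes L :: "('a::compact_metric_space \<Rightarrow> real) \<Rightarrow> real"
  assumes add: "\<And>f g. continuous_on UNIV f \<Longrightarrow> continuous_on UNIV g \<Longrightarrow> L (\<lambda>x. f x + g x) = L f + L g"
    and scale: "\<And>c f. continuous_on UNIV f \<Longrightarrow> L (\<lambda>x. c * f x) = c * L f"
    and nonneg: "\<And>f. continuous_on UNIV f \<Longrightarrow> (\<And>x. f x \<ge> 0) \<Longrightarrow> L f \<ge> 0"
begin

lemma diff:
  assumes "continuous_on UNIV f" "continuous_on UNIV g"
  shows "L (\<lambda>x. f x - g x) = L f - L g"
  using add[of f "\<lambda>x. (-1) * g x"] scale[of g "-1"] assms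
  by (simp add: continuous_on_minus)

lemma mono:
  assumes "continuous_on UNIV f" "continuous_on UNIV g" "\<And>x. f x \<le> g x"
  shows "L f \<le> L g"
  using nonneg[of "\<lambda>x. g x - f x"] diff[of g f] assms by (simp add: continuous_on_diff)

lemma zero: "L (\<lambda>x. 0) = 0"
  using scale[of "\<lambda>x. 0" 0] by simp

lemma const: "L (\<lambda>x. c) = c * L (\<lambda>x. 1)"
  using scale[of "\<lambda>x. 1" c] by simp

lemma sum:
  assumes "\<And>i. i \<in> I \<Longrightarrow> continuous_on UNIV (f i)"
  shows "L (\<lambda>x. \<Sum>i\<in>I. f i x) = (\<Sum>i\<in>I. L (f i))"
  using assms
proof (induction I rule: infinite_finite_induct)
  case (insert i I)
  then show ?case by (simp add: add continuous_on_sum)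
qed (auto simp: zero)

text \<open>As in Daniell's construction, sets are covered by series of nonnegative continuous
  functions instead of open sets, so that \<open>L\<close> applies directly to the pieces. The
  series is taken in \<open>ennreal\<close> and may diverge.\<close>

definition covers :: "'a set \<Rightarrow> (nat \<Rightarrow> 'a \<Rightarrow> real) set" where
  "covers E = {f. (\<forall>n. continuous_on UNIV (f n) \<and> (\<forall>x. f n x \<ge> 0)) \<and>
                  (\<forall>x\<in>E. 1 \<le> (\<Sum>n. ennreal (f n x)))}"

definition outer :: "'a set \<Rightarrow> ennreal" where
  "outer E = (INF f\<in>covers E. \<Sum>n. ennreal (L (f n)))"

lemma coversD:
  assumes "f \<in> covers E"
  shows "continuous_on UNIV (f n)" "f n x \<ge> 0" "x \<in> E \<Longrightarrow> 1 \<le> (\<Sum>n. ennreal (f n x))" "L (f n) \<ge> 0"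
  using assms nonneg by (auto simp: covers_def)

lemma outer_le:
  "f \<in> covers E \<Longrightarrow> outer E \<le> (\<Sum>n. ennreal (L (f n)))"
  unfolding outer_def by (rule INF_lower)

text \<open>Reindexing by \<open>prod_decode\<close> turns a double family into one sequence. Double
  families arise both from countable subadditivity and from splitting each function of a cover by
  cutoffs.\<close>

lemma outer_le_double:
  assumes "\<And>i n. continuous_on UNIV (f i n)" "\<And>i n x. f i n x \<ge> 0"
    and "\<And>x. x \<in> E \<Longrightarrow> 1 \<le> (\<Sum>i. \<Sum>n. ennreal (f i n x))"
  shows "outer E \<le> (\<Sum>i. \<Sum>n. ennreal (L (f i n)))"
proof -
  let ?g = "\<lambda>k. case_prod f (prod_decode k)"
  have "(\<Sum>k. ennreal (?g k x)) = (\<Sum>i. \<Sum>n. ennreal (f i n x))" for x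
    using suminf_ennreal_2dimen[of "\<lambda>i. \<Sum>n. ennreal (f i n x)" "\<lambda>(i,n). ennreal (f i n x)"]
    by (simp add: split_def o_def)
  then have "?g \<in> covers E"
    using assms by (auto simp: covers_def split: prod.split)
  then have "outer E \<le> (\<Sum>k. ennreal (L (?g k)))" by (rule outer_le)
  also have "\<dots> = (\<Sum>i. \<Sum>n. ennreal (L (f i n)))"
    using suminf_ennreal_2dimen[of "\<lambda>i. \<Sum>n. ennreal (L (f i n))" "\<lambda>(i,n). ennreal (L (f i n))"]
    by (simp add: split_def o_def)
  finally show ?thesis .
qed

lemma outer_le_single:
  assumes "continuous_on UNIV g" "\<And>x. g x \<ge> 0" "\<And>x. x \<in> E \<Longrightarrow> g x \<ge> 1"
  shows "outer E \<le> ennreal (L g)"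
proof -
  let ?f = "\<lambda>n::nat. if n = 0 then g else (\<lambda>x. 0)"
  have fin: "(\<Sum>n. ennreal (?f n x)) = ennreal (g x)" for x
    by (subst suminf_finite[of "{0}"]) auto
  have "?f \<in> covers E"
    using assms fin by (auto simp: covers_def)
  then have "outer E \<le> (\<Sum>n. ennreal (L (?f n)))" by (rule outer_le)
  also have "\<dots> = ennreal (L g)"
    by (subst suminf_finite[of "{0}"]) (auto simp: zero)
  finally show ?thesis .
qed

lemma outer_mono: "E \<subseteq> E' \<Longrightarrow> outer E \<le> outer E'"
  unfolding outer_def by (rule INF_superset_mono) (auto simp: covers_def)

lemma outer_empty: "outer {} = 0"
  using outer_le_single[of "\<lambda>x. 0" "{}"] by (simp add: zero)

lemma outer_UNION: "outer (\<Union>i. E i) \<le> (\<Sum>i. outer (E i))" for E :: "nat \<Rightarrow> 'a set"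
proof (rule ennreal_le_epsilon)
  fix e :: real assume e: "0 < e" and "(\<Sum>i. outer (E i)) < top"
  then have *: "\<And>i. outer (E i) < outer (E i) + e * (1/2)^Suc i"
    by (auto simp add: less_top dest!: ennreal_suminf_lessD)
  have "\<exists>f\<in>covers (E i). (\<Sum>n. ennreal (L (f n))) \<le> outer (E i) + e * (1/2)^Suc i" for i
    using *[of i] unfolding outer_def[of "E i"] INF_less_iff by (auto intro: less_imp_le)
  then obtain f where f: "\<And>i. f i \<in> covers (E i)"
    "\<And>i. (\<Sum>n. ennreal (L (f i n))) \<le> outer (E i) + e * (1/2)^Suc i"
    by metis
  have "outer (\<Union>i. E i) \<le> (\<Sum>i. \<Sum>n. ennreal (L (f i n)))"
  proof (rule outer_le_double)
    fix x assume "x \<in> (\<Union>i. E i)"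
    then obtain i where "x \<in> E i" by blast
    then have "1 \<le> (\<Sum>n. ennreal (f i n x))" using f(1) coversD(3) by blast
    also have "\<dots> \<le> (\<Sum>i. \<Sum>n. ennreal (f i n x))"
      using sum_le_suminf[of "\<lambda>i. \<Sum>n. ennreal (f i n x)" "{i}"] by simp
    finally show "1 \<le> (\<Sum>i. \<Sum>n. ennreal (f i n x))" .
  qed (use f(1) coversD in blast)+
  also have "\<dots> \<le> (\<Sum>i. outer (E i) + e * (1/2) ^ Suc i)"
    by (intro suminf_le allI f(2)) auto
  also have "\<dots> = (\<Sum>i. outer (E i)) + (\<Sum>i. ennreal e * ennreal ((1/2) ^ Suc i))"
    using e by (subst suminf_add[symmetric])
               (auto simp del: ennreal_suminf_cmult simp add: ennreal_mult[symmetric])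
  also have "\<dots> = (\<Sum>i. outer (E i)) + e"
    unfolding ennreal_suminf_cmult
    by (subst suminf_ennreal_eq[OF zero_le_power power_half_series]) auto
  finally show "outer (\<Union>i. E i) \<le> (\<Sum>i. outer (E i)) + e" .
qed

lemma outer_measure_space_outer: "outer_measure_space (Pow UNIV) outer"
  unfolding outer_measure_space_def positive_def increasing_def countably_subadditive_def
  using outer_empty outer_mono outer_UNION by auto

text \<open>
  A cover of \<open>E\<close> is split by the cutoffs of \<open>G\<close>; since \<open>1 - indicator G\<close> is the sum of the successive
  differences of the cutoffs, the complementary part is covered exactly, and no argument with
  sets at positive distance is needed.
\<close>

lemma outer_closed_split:
  assumes G: "closed G" "G \<noteq> {}"
  shows "outer (G \<inter> E) + outer (- G \<inter> E) \<le> outer E"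
proof -
  have "outer (G \<inter> E) + outer (- G \<inter> E) \<le> (\<Sum>n. ennreal (L (f n)))" if f: "f \<in> covers E" for f
  proof -
    note fc = coversD(1)[OF f] and f0 = coversD(2)[OF f]
    define p where "p = (\<lambda>n j x. f n x * cutoff G j x)"
    have pc: "continuous_on UNIV (p n j)" for n j
      unfolding p_def by (intro continuous_intros fc)
    have p0: "p n j x \<ge> 0" for n j x unfolding p_def using f0 by simp
    have pdec: "p n (Suc j) x \<le> p n j x" for n j x
      unfolding p_def using cutoff_decseq[of G x] f0 by (auto simp: decseq_Suc_iff intro!: mult_left_mono)
    have Lp0: "L (p n j) \<ge> 0" for n j by (intro nonneg pc p0)
    have Lpdec: "decseq (\<lambda>j. L (p n j))" for n
      unfolding decseq_Suc_iff by (intro allI mono pc pdec)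
    have p_0: "p n 0 = f n" for n by (simp add: p_def)
    \<comment> \<open>\<open>l n\<close> is the mass that \<open>f n\<close> will put on
      \<open>G\<close>; the differences of successive cutoffs telescope to the remainder
      \<open>L (f n) - l n\<close>.\<close>
    obtain l where l: "\<And>n. (\<lambda>j. L (p n j)) \<longlonglongrightarrow> l n" and lle: "\<And>n j. l n \<le> L (p n j)"
    proof -
      have "\<exists>l. (\<lambda>j. L (p n j)) \<longlonglongrightarrow> l \<and> (\<forall>j. l \<le> L (p n j))" for n
        by (rule decseq_convergent[OF Lpdec[of n], of 0]) (use Lp0 in auto)
      then show ?thesis using that by metis
    qed
    have l0: "l n \<ge> 0" for n by (rule LIMSEQ_le_const[OF l]) (use Lp0 in auto)
    have outside: "outer (- G \<inter> E) \<le> (\<Sum>n. ennreal (L (f n) - l n))"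
    proof -
      let ?q = "\<lambda>n j x. p n j x - p n (Suc j) x"
      have "outer (- G \<inter> E) \<le> (\<Sum>n. \<Sum>j. ennreal (L (?q n j)))"
      proof (rule outer_le_double)
        fix x assume x: "x \<in> - G \<inter> E"
        have "(\<lambda>j. p n j x) \<longlonglongrightarrow> 0" for n
          using tendsto_mult[OF tendsto_const cutoff_tendsto[OF G], of "f n x" x] x by (simp add: p_def)
        then have "(\<lambda>j. ?q n j x) sums (p n 0 x - 0)" for n
          by (rule telescope_sums')
        then have "(\<Sum>j. ennreal (?q n j x)) = ennreal (f n x)" for n
          using pdec p_0 by (subst suminf_ennreal_eq[of _ "f n x"]) (auto simp: p_0)
        then show "1 \<le> (\<Sum>n. \<Sum>j. ennreal (?q n j x))"
          using coversD(3)[OF f] x by simp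
      qed (auto intro!: continuous_intros pc pdec)
      moreover have "(\<Sum>j. ennreal (L (?q n j))) = ennreal (L (f n) - l n)" for n
      proof -
        have "(\<lambda>j. L (?q n j)) sums (L (p n 0) - l n)"
          using telescope_sums'[OF l] pc by (simp add: diff)
        then show ?thesis
          using Lpdec by (subst suminf_ennreal_eq) (auto simp: p_0 diff pc decseq_Suc_iff)
      qed
      ultimately show ?thesis by simp
    qed
    have inside: "outer (G \<inter> E) \<le> (\<Sum>n. ennreal (l n)) + e" if e: "e > 0" for e :: real
    proof -
      \<comment> \<open>The index may depend on \<open>n\<close>, because every cutoff equals
        \<open>1\<close> on \<open>G\<close>: the modified sequence still covers
        \<open>G \<inter> E\<close>.\<close>
      have "\<exists>j. L (p n j) < l n + e * (1/2)^Suc n" for n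
        using order_tendstoD(2)[OF l, of n "l n + e * (1/2)^Suc n"] e
        by (auto simp: eventually_sequentially)
      then obtain J where J: "\<And>n. L (p n (J n)) < l n + e * (1/2)^Suc n" by metis
      have "(\<lambda>n. p n (J n)) \<in> covers (G \<inter> E)"
        using pc p0 coversD(3)[OF f] by (auto simp: covers_def p_def cutoff_on)
      then have "outer (G \<inter> E) \<le> (\<Sum>n. ennreal (L (p n (J n))))" by (rule outer_le)
      also have "\<dots> \<le> (\<Sum>n. ennreal (l n) + ennreal e * ennreal ((1/2)^Suc n))"
      proof (intro suminf_le)
        fix n
        show "ennreal (L (p n (J n))) \<le> ennreal (l n) + ennreal e * ennreal ((1/2)^Suc n)"
          using J[of n] l0[of n] e
          by (auto simp: ennreal_mult[symmetric] ennreal_plus[symmetric] intro!: ennreal_leI simp del: ennreal_plus)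
      qed auto
      also have "\<dots> = (\<Sum>n. ennreal (l n)) + (\<Sum>n. ennreal e * ennreal ((1/2)^Suc n))"
        by (subst suminf_add[symmetric]) auto
      also have "\<dots> = (\<Sum>n. ennreal (l n)) + e"
        unfolding ennreal_suminf_cmult
        by (subst suminf_ennreal_eq[OF zero_le_power power_half_series]) auto
      finally show ?thesis .
    qed
    have "outer (G \<inter> E) \<le> (\<Sum>n. ennreal (l n))"
      by (rule ennreal_le_epsilon) (rule inside)
    then have "outer (G \<inter> E) + outer (- G \<inter> E)
        \<le> (\<Sum>n. ennreal (l n)) + (\<Sum>n. ennreal (L (f n) - l n))"
      using outside by (rule add_mono)
    also have "\<dots> = (\<Sum>n. ennreal (l n) + ennreal (L (f n) - l n))"
      by (rule suminf_add) auto
    also have "\<dots> = (\<Sum>n. ennreal (L (f n)))"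
    proof (rule suminf_cong)
      fix n
      have "L (f n) - l n \<ge> 0" using lle[of n 0] p_0 by simp
      then show "ennreal (l n) + ennreal (L (f n) - l n) = ennreal (L (f n))"
        using l0[of n] by (simp add: ennreal_plus[symmetric] del: ennreal_plus)
    qed
    finally show ?thesis .
  qed
  then show ?thesis unfolding outer_def[of E] by (rule INF_greatest)
qed

text \<open>For the lower bound, Dini's argument finds a finite partial sum of the cover that
  exceeds \<open>1 - e\<close> everywhere; on finite sums \<open>L\<close> is additive and
  monotone.\<close>

lemma outer_UNIV: "outer UNIV = ennreal (L (\<lambda>x. 1))"
proof (rule antisym)
  show "outer UNIV \<le> ennreal (L (\<lambda>x. 1))"
    by (rule outer_le_single) auto
  have "ennreal (L (\<lambda>x. 1)) \<le> (\<Sum>n. ennreal (L (f n)))" if f: "f \<in> covers UNIV" for f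
  proof -
    note fc = coversD(1)[OF f] and f0 = coversD(2)[OF f]
    have main: "(1 - e) * L (\<lambda>x. 1) \<le> (\<Sum>n. ennreal (L (f n)))" if e: "e > 0" "e < 1" for e
    proof -
      have "\<exists>N. \<forall>x. - (\<Sum>n<N. f n x) < - (1 - e)"
      proof (rule dini_upper)
        show "continuous_on UNIV (\<lambda>x. - (\<Sum>n<N. f n x))" for N
          by (intro continuous_intros fc)
        show "decseq (\<lambda>N. - (\<Sum>n<N. f n x))" for x
          using f0 by (auto simp: decseq_Suc_iff)
        fix x
        have "ennreal (1 - e) < 1" using e by (simp add: ennreal_less_one_iff)
        also have "1 \<le> (\<Sum>n. ennreal (f n x))" using coversD(3)[OF f] by simp
        finally have "ennreal (1 - e) < (\<Sum>n. ennreal (f n x))" .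
        then have "\<exists>N. ennreal (1 - e) < (\<Sum>n<N. ennreal (f n x))"
          unfolding suminf_eq_SUP by (auto simp: less_SUP_iff)
        then obtain N where "ennreal (1 - e) < ennreal (\<Sum>n<N. f n x)"
          using f0 by auto
        then have "1 - e < (\<Sum>n<N. f n x)"
          using e by (simp add: ennreal_less_iff)
        then show "\<exists>N. - (\<Sum>n<N. f n x) < - (1 - e)" by (intro exI[of _ N]) simp
      qed
      then obtain N where "\<forall>x. - (\<Sum>n<N. f n x) < - (1 - e)" ..
      then have N: "1 - e < (\<Sum>n<N. f n x)" for x by (metis neg_less_iff_less)
      have "(1 - e) * L (\<lambda>x. 1) = L (\<lambda>x. 1 - e)" by (rule const[symmetric])
      also have "\<dots> \<le> L (\<lambda>x. \<Sum>n<N. f n x)"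
        by (intro mono continuous_intros fc less_imp_le N)
      also have "\<dots> = (\<Sum>n<N. L (f n))" by (rule sum) (rule fc)
      finally have "ennreal ((1 - e) * L (\<lambda>x. 1)) \<le> ennreal (\<Sum>n<N. L (f n))"
        by (rule ennreal_leI)
      also have "\<dots> = (\<Sum>n<N. ennreal (L (f n)))"
        using coversD(4)[OF f] by simp
      also have "\<dots> \<le> (\<Sum>n. ennreal (L (f n)))" by (rule sum_le_suminf) auto
      finally show ?thesis .
    qed
    \<comment> \<open>Starting at \<open>1/2\<close> keeps \<open>e k\<close> strictly between
      \<open>0\<close> and \<open>1\<close>, as \<open>main\<close> requires.\<close>
    define e where "e = (\<lambda>k. inverse (real (Suc (Suc k))))"
    have "e \<longlonglongrightarrow> 0"
      unfolding e_def using LIMSEQ_Suc[OF LIMSEQ_inverse_real_of_nat] by simp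
    then have lim: "(\<lambda>k. ennreal ((1 - e k) * L (\<lambda>x. 1))) \<longlonglongrightarrow> ennreal ((1 - 0) * L (\<lambda>x. 1))"
      by (intro tendsto_ennrealI tendsto_intros)
    have "e k > 0" "e k < 1" for k by (auto simp: e_def field_simps)
    then show ?thesis
      using LIMSEQ_le_const2[OF lim] main by simp
  qed
  then show "ennreal (L (\<lambda>x. 1)) \<le> outer UNIV" unfolding outer_def by (rule INF_greatest)
qed

text \<open>Caratheodory: \<open>outer_closed_split\<close> and subadditivity put every closed set
  into the lambda system, and closed sets generate the Borel sets. The empty set is treated apart
  because the cutoffs need a nonempty set.\<close>

lemma measure_space_outer: "measure_space UNIV (sets borel) outer"
proof -
  interpret P: sigma_algebra "UNIV :: 'a set" "Pow UNIV" by (rule sigma_algebra_Pow)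
  have ms: "measure_space UNIV (lambda_system UNIV (Pow UNIV) outer) outer"
    by (rule P.caratheodory_lemma) (rule outer_measure_space_outer)
  then have sa: "sigma_algebra UNIV (lambda_system UNIV (Pow UNIV) outer)"
    by (simp add: measure_space_def)
  have "G \<in> lambda_system UNIV (Pow UNIV) outer" if G: "closed G" for G
  proof (cases "G = {}")
    case True
    then show ?thesis by (simp add: lambda_system_def outer_empty)
  next
    case False
    have "outer (G \<inter> E) + outer (- G \<inter> E) = outer E" for E
    proof (rule antisym[OF outer_closed_split[OF G False]])
      have "subadditive (Pow UNIV) outer"
        using P.countably_subadditive_subadditive outer_measure_space_outer
        by (auto simp: outer_measure_space_def)
      then have "outer ((G \<inter> E) \<union> (- G \<inter> E)) \<le> outer (G \<inter> E) + outer (- G \<inter> E)"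
        by (rule subadditiveD) auto
      moreover have "(G \<inter> E) \<union> (- G \<inter> E) = E" by blast
      ultimately show "outer E \<le> outer (G \<inter> E) + outer (- G \<inter> E)" by simp
    qed
    then show ?thesis by (simp add: lambda_system_def Compl_eq_Diff_UNIV)
  qed
  then have "sigma_sets UNIV (Collect closed) \<subseteq> lambda_system UNIV (Pow UNIV) outer"
    by (intro sigma_algebra.sigma_sets_subset[OF sa]) auto
  moreover have "sets borel = sigma_sets UNIV (Collect (closed :: 'a set \<Rightarrow> bool))"
    by (simp add: borel_eq_closed)
  ultimately show ?thesis
    using measure_down[OF ms sets.sigma_algebra_axioms[of borel, simplified]] by simp
qed

definition representing :: "'a measure" where
  "representing = measure_of UNIV (sets borel) outer"

lemma sets_representing [simp, measurable_cong]: "sets representing = sets borel"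
  unfolding representing_def using sets.sigma_sets_eq[of "borel :: 'a measure"] by simp

lemma space_representing [simp]: "space representing = UNIV"
  using sets_eq_imp_space_eq[OF sets_representing] by simp

lemma emeasure_representing: "B \<in> sets borel \<Longrightarrow> emeasure representing B = outer B"
  unfolding representing_def using measure_space_outer
  by (subst emeasure_measure_of_sigma) (auto simp: measure_space_def sets.sigma_algebra_axioms)

lemma finite_representing: "finite_measure representing"
  by (rule finite_measureI) (simp add: emeasure_representing outer_UNIV)

lemma measure_representing_UNIV: "measure representing UNIV = L (\<lambda>x. 1)"
  using nonneg[of "\<lambda>x. 1"] by (simp add: measure_def emeasure_representing outer_UNIV)

end

section \<open>Integrals against the representing measure\<close>

lemma integrable_continuous:
  fixes f :: "'a::compact_metric_space \<Rightarrow> 'b::{banach, second_countable_topology}"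
  assumes "sets M = sets borel" "finite_measure M" "continuous_on UNIV f"
  shows "integrable M f"
proof -
  interpret finite_measure M by fact
  have "bounded (range f)"
    using compact_continuous_image[OF assms(3) compact_carrier] by (rule compact_imp_bounded)
  then obtain B where "\<And>x. norm (f x) \<le> B" by (auto simp: bounded_iff)
  moreover have "f \<in> borel_measurable M"
    using borel_measurable_continuous_onI[OF assms(3)] assms(1) measurable_cong_sets by blast
  ultimately show ?thesis by (intro integrable_const_bound) auto
qed

context positive_functional
begin

text \<open>Layer cake with \<open>N\<close> layers: \<open>g i\<close> is the part of
  \<open>f\<close> between the heights \<open>i / N\<close> and \<open>(i + 1) / N\<close>. Since
  \<open>N * g i\<close> is at least \<open>1\<close> on the superlevel set \<open>S i\<close>, that
  set has measure at most \<open>N * L (g i)\<close>; summation leaves an error of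
  \<open>1 / N\<close> times the total mass.\<close>

lemma integral_le_unit:
  assumes f: "continuous_on UNIV f" "\<And>x. f x \<ge> 0" "\<And>x. f x \<le> 1"
  shows "integral\<^sup>L representing f \<le> L f"
proof -
  interpret M: finite_measure representing by (rule finite_representing)
  let ?c = "L (\<lambda>x. 1)"
  have c0: "?c \<ge> 0" by (rule nonneg) auto
  have bound: "integral\<^sup>L representing f \<le> ?c / real N + L f" if N: "N > 0" for N :: nat
  proof -
    define g where "g = (\<lambda>i x. min (max (f x - real i / N) 0) (1 / N))"
    have gc: "continuous_on UNIV (g i)" for i unfolding g_def by (intro continuous_intros f)
    have g0: "g i x \<ge> 0" for i x unfolding g_def by simp
    have gsum: "(\<Sum>i<k. g i x) = min (f x) (real k / N)" for k x
    proof (induction k)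
      case 0 then show ?case using f(2)[of x] by simp
    next
      case (Suc k)
      have "(\<Sum>i<Suc k. g i x) = min (f x) (real k / N) + g k x" using Suc by simp
      also have "\<dots> = min (f x) (real (Suc k) / N)"
        unfolding g_def min_def max_def of_nat_Suc add_divide_distrib
        using zero_le_divide_1_iff[of "real N"] by (simp; linarith)
      finally show ?case .
    qed
    then have fsum: "f x = (\<Sum>i<N. g i x)" for x using f(3)[of x] N by simp
    define S where "S = (\<lambda>i. {x. f x \<ge> real (Suc i) / N})"
    have Scl: "closed (S i)" for i unfolding S_def by (intro closed_Collect_le f continuous_intros)
    have mS: "measure representing (S i) \<le> N * L (g i)" for i
    proof -
      have "emeasure representing (S i) \<le> ennreal (L (\<lambda>x. N * g i x))"
        unfolding emeasure_representing[OF borel_closed[OF Scl]]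
      proof (rule outer_le_single)
        fix x assume "x \<in> S i"
        then have "g i x = 1 / N" using N by (auto simp: S_def g_def field_simps)
        then show "real N * g i x \<ge> 1" using N by simp
      qed (intro continuous_intros gc mult_nonneg_nonneg of_nat_0_le_iff g0)+
      moreover have "L (\<lambda>x. N * g i x) = N * L (g i)" by (rule scale[OF gc])
      moreover have "L (g i) \<ge> 0" by (intro nonneg gc g0)
      ultimately show ?thesis by (simp add: M.emeasure_eq_measure)
    qed
    \<comment> \<open>Full layers at \<open>x\<close> are counted by the indicators. At most one
      layer is only partly filled, namely the one with index the floor of \<open>f x * N\<close>,
      and it contributes at most \<open>1 / N\<close>.\<close>
    have ind: "f x \<le> 1 / N + (\<Sum>i<N. 1 / N * indicator (S i) x)" for x
    proof -
      have "g i x \<le> (1 / N) * (if real i / N \<le> f x \<and> \<not> real (Suc i) / N \<le> f x then 1 else 0)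
                + 1 / N * indicator (S i) x" for i
        using N by (auto simp: g_def S_def indicator_def)
      then have "f x \<le> (\<Sum>i<N. (1 / N) * (if real i / N \<le> f x \<and> \<not> real (Suc i) / N \<le> f x then 1 else 0)
                + 1 / N * indicator (S i) x)"
        unfolding fsum[of x] by (rule sum_mono)
      also have "\<dots> = (1 / N) * (\<Sum>i<N. if real i / N \<le> f x \<and> \<not> real (Suc i) / N \<le> f x then 1 else 0)
                + (\<Sum>i<N. 1 / N * indicator (S i) x)"
        by (simp add: sum.distrib sum_distrib_left)
      also have "(\<Sum>i<N. if real i / N \<le> f x \<and> \<not> real (Suc i) / N \<le> f x then 1 else 0)
          = real (card {i\<in>{..<N}. real i / N \<le> f x \<and> \<not> real (Suc i) / N \<le> f x})"
        by (simp add: sum.If_cases Int_def)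
      also have "\<dots> \<le> 1"
      proof -
        have "{i\<in>{..<N}. real i / N \<le> f x \<and> \<not> real (Suc i) / N \<le> f x} \<subseteq> {nat \<lfloor>f x * N\<rfloor>}"
        proof
          fix i assume "i \<in> {i\<in>{..<N}. real i / N \<le> f x \<and> \<not> real (Suc i) / N \<le> f x}"
          then have "real i \<le> f x * N" "f x * N < real i + 1" using N by (auto simp: field_simps)
          then have "\<lfloor>f x * N\<rfloor> = int i" by linarith
          then show "i \<in> {nat \<lfloor>f x * N\<rfloor>}" by simp
        qed
        from card_mono[OF _ this] show ?thesis by simp
      qed
      finally show ?thesis using N by (simp add: divide_right_mono)
    qed
    have Sm: "S i \<in> sets representing" for i using Scl by (simp add: borel_closed)
    have Si: "integrable representing (\<lambda>x. 1 / N * indicator (S i) x :: real)" for i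
      using Sm by (intro integrable_mult_right integrable_real_indicator) (auto simp: M.emeasure_eq_measure)
    have "integral\<^sup>L representing f
        \<le> (LINT x|representing. 1 / N + (\<Sum>i<N. 1 / N * indicator (S i) x))"
    proof (rule integral_mono[OF _ _ ind])
      show "integrable representing f"
        by (intro integrable_continuous finite_representing f) simp
      show "integrable representing (\<lambda>x. 1 / N + (\<Sum>i<N. 1 / N * indicator (S i) x))"
        by (intro Bochner_Integration.integrable_add Bochner_Integration.integrable_sum M.integrable_const Si)
    qed
    also have "\<dots> = ?c / N + (\<Sum>i<N. 1 / N * measure representing (S i))"
    proof (subst Bochner_Integration.integral_add)
      show "integrable representing (\<lambda>x. \<Sum>i<N. 1 / N * indicator (S i) x :: real)"
        by (intro Bochner_Integration.integrable_sum Si)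
      show "(LINT x|representing. 1 / N) + (LINT x|representing. (\<Sum>i<N. 1 / N * indicator (S i) x))
          = ?c / N + (\<Sum>i<N. 1 / N * measure representing (S i))"
        using Sm by (subst Bochner_Integration.integral_sum[OF Si]) (simp add: measure_representing_UNIV)
    qed simp
    also have "\<dots> \<le> ?c / N + (\<Sum>i<N. L (g i))"
      using mS N by (intro add_left_mono sum_mono) (simp add: field_simps)
    also have "(\<Sum>i<N. L (g i)) = L (\<lambda>x. \<Sum>i<N. g i x)" by (rule sum[symmetric]) (rule gc)
    also have "(\<lambda>x. \<Sum>i<N. g i x) = f" using fsum by auto
    finally show ?thesis .
  qed
  have "(\<lambda>k. ?c / real (Suc k) + L f) \<longlonglongrightarrow> 0 + L f"
    by (intro tendsto_add tendsto_const LIMSEQ_Suc[OF lim_const_over_n])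
  moreover have "integral\<^sup>L representing f \<le> ?c / real (Suc k) + L f" for k
    by (rule bound) simp
  ultimately have "integral\<^sup>L representing f \<le> 0 + L f"
    by (intro LIMSEQ_le_const) auto
  then show ?thesis by simp
qed

text \<open>For values in the unit interval, the upper bound applied to \<open>g\<close> and to
  \<open>1 - g\<close> gives equality, because the total mass is \<open>L (\<lambda>x. 1)\<close>. A
  general \<open>f\<close> is an affine image of such a \<open>g\<close>.\<close>

theorem integral_representing:
  assumes f: "continuous_on UNIV f"
  shows "integral\<^sup>L representing f = L f"
proof -
  interpret M: finite_measure representing by (rule finite_representing)
  note int = integrable_continuous[OF sets_representing finite_representing]
  have unit: "integral\<^sup>L representing g = L g"
    if g: "continuous_on UNIV g" "\<And>x. g x \<ge> 0" "\<And>x. g x \<le> 1" for g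
  proof -
    have "integral\<^sup>L representing (\<lambda>x. 1 - g x) \<le> L (\<lambda>x. 1 - g x)"
      using g by (intro integral_le_unit continuous_intros) auto
    then have "integral\<^sup>L representing g \<ge> L g"
      using int[OF g(1)] g(1) by (simp add: diff measure_representing_UNIV)
    then show ?thesis using integral_le_unit[OF g] by simp
  qed
  have "bounded (range f)"
    using compact_continuous_image[OF f compact_carrier] by (rule compact_imp_bounded)
  then obtain B where B: "B > 0" "\<And>x. \<bar>f x\<bar> \<le> B" by (auto simp: bounded_pos)
  define g where "g = (\<lambda>x. (f x + B) / (2 * B))"
  have "f x + B \<ge> 0" "f x + B \<le> 2 * B" for x using B(2)[of x] by linarith+
  then have g: "continuous_on UNIV g" "\<And>x. g x \<ge> 0" "\<And>x. g x \<le> 1"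
    unfolding g_def using B(1) f by (auto intro!: continuous_intros)
  have feq: "f = (\<lambda>x. 2 * B * g x + (- B) * 1)" using B(1) by (auto simp: g_def)
  have "integral\<^sup>L representing f = 2 * B * integral\<^sup>L representing g + (- B) * L (\<lambda>x. 1)"
    unfolding feq using int[OF g(1)] by (simp add: measure_representing_UNIV)
  also have "\<dots> = L f"
    unfolding unit[OF g] feq using g(1) by (subst add) (auto intro!: continuous_intros simp: scale const[of "-B"])
  finally show ?thesis .
qed

end

text \<open>Integrals of cutoffs converge to the measure of a closed set by dominated convergence,
  and closed sets are an intersection-stable generator.\<close>

lemma finite_borel_measure_eqI:
  fixes M N :: "'a::compact_metric_space measure"
  assumes M: "sets M = sets borel" "finite_measure M" and N: "sets N = sets borel" "finite_measure N"
    and eq: "\<And>f :: 'a \<Rightarrow> real. continuous_on UNIV f \<Longrightarrow> integral\<^sup>L M f = integral\<^sup>L N f"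
  shows "M = N"
proof -
  have lim: "(\<lambda>j. integral\<^sup>L K (cutoff G j)) \<longlonglongrightarrow> measure K G"
    if K: "sets K = sets borel" "finite_measure K" and G: "closed G" "G \<noteq> {}" for K :: "'a measure" and G
  proof -
    interpret finite_measure K by fact
    have [measurable]: "cutoff G j \<in> borel_measurable K" for j
      using borel_measurable_continuous_onI[OF continuous_on_cutoff] K(1) measurable_cong_sets by blast
    have [measurable]: "G \<in> sets K" using G K by (simp add: borel_closed)
    have "(\<lambda>j. integral\<^sup>L K (cutoff G j)) \<longlonglongrightarrow> integral\<^sup>L K (indicator G)"
      by (rule integral_dominated_convergence[where w = "\<lambda>_. 1"]) (simp_all add: cutoff_tendsto G)
    then show ?thesis using sets_eq_imp_space_eq[OF K(1)] by simp
  qed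
  have "measure M G = measure N G" if "closed G" for G
  proof (cases "G = {}")
    case False
    show ?thesis
      using lim[OF M that False] lim[OF N that False] eq[OF continuous_on_cutoff]
      by (simp add: LIMSEQ_unique)
  qed simp
  then have e: "emeasure M G = emeasure N G" if "closed G" for G
    using that M(2) N(2) by (simp add: finite_measure.emeasure_eq_measure)
  show ?thesis
  proof (rule measure_eqI_generator_eq[where E = "Collect closed" and \<Omega> = UNIV and A = "\<lambda>_. UNIV"])
    show "sets M = sigma_sets UNIV (Collect closed)" "sets N = sigma_sets UNIV (Collect closed)"
      using M N by (simp_all add: borel_eq_closed)
    show "emeasure M UNIV \<noteq> \<infinity>" for i :: nat
      using M by (simp add: finite_measure.emeasure_eq_measure)
  qed (auto simp: Int_stable_def e)
qed

section \<open>Fibre measures and invariant measures\<close>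

lemma regular_borel_measureI:
  fixes M :: "'a::polish_space measure"
  assumes M: "sets M = sets borel" "finite_measure M"
  shows "regular_borel_measure M"
proof -
  have top: "emeasure M (space M) \<noteq> \<infinity>"
    using M(2) by (simp add: finite_measure.emeasure_eq_measure)
  show ?thesis
    unfolding regular_borel_measure_def
    by (intro conjI ballI M inner_regular[OF M(1) top] outer_regular[OF M(1) top])
qed

section \<open>Fibre measures of a transfer operator\<close>

locale transfer =
  fixes \<alpha> :: "'a::compact_metric_space \<Rightarrow> 'a"
    and A :: "('a \<Rightarrow>\<^sub>C complex) \<Rightarrow> ('a \<Rightarrow>\<^sub>C complex)"
  assumes cont: "continuous_on UNIV \<alpha>"
    and transfer: "transfer_operator \<alpha> A"
begin

text \<open>The operator on plain functions. \<open>Bcontfun\<close> is controlled only on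
  continuous arguments, so every law of \<open>T\<close> assumes continuity.\<close>

definition T :: "('a \<Rightarrow> complex) \<Rightarrow> 'a \<Rightarrow> complex" where
  "T f = apply_bcontfun (A (Bcontfun f))"

lemma T_add:
  assumes "continuous_on UNIV f" "continuous_on UNIV g"
  shows "T (\<lambda>x. f x + g x) x = T f x + T g x"
proof -
  have "Bcontfun (\<lambda>x. f x + g x) = Bcontfun f + Bcontfun g"
    using assms by (intro bcontfun_eqI) (simp add: apply_Bcontfun_compact continuous_on_add)
  then show ?thesis
    using transfer by (simp add: T_def transfer_operator_def)
qed

lemma T_scale:
  assumes "continuous_on UNIV f"
  shows "T (\<lambda>x. c * f x) x = c * T f x"
proof -
  have "A (Bcontfun (\<lambda>x. c * apply_bcontfun (Bcontfun f) x))
      = Bcontfun (\<lambda>x. c * apply_bcontfun (A (Bcontfun f)) x)"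
    using transfer unfolding transfer_operator_def by blast
  then show ?thesis
    using assms by (simp add: T_def apply_Bcontfun_compact continuous_on_mult_left)
qed

lemma T_nonneg:
  assumes "continuous_on UNIV f" "\<And>x. f x \<in> \<real>\<^sub>\<ge>\<^sub>0"
  shows "T f x \<in> \<real>\<^sub>\<ge>\<^sub>0"
  using transfer assms unfolding transfer_operator_def T_def by (metis apply_Bcontfun_compact)

lemma T_homological:
  assumes "continuous_on UNIV f" "continuous_on UNIV g"
  shows "T (\<lambda>x. f (\<alpha> x) * g x) x = f x * T g x"
proof -
  have "A (Bcontfun (\<lambda>x. apply_bcontfun (Bcontfun f) (\<alpha> x) * apply_bcontfun (Bcontfun g) x))
      = Bcontfun (\<lambda>x. apply_bcontfun (Bcontfun f) x * apply_bcontfun (A (Bcontfun g)) x)"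
    using transfer unfolding transfer_operator_def by blast
  then show ?thesis
    using assms by (simp add: T_def apply_Bcontfun_compact continuous_on_mult)
qed

text \<open>Positivity makes the images of \<open>g + B\<close> and of the constant \<open>B\<close>
  real, hence also their difference.\<close>

lemma T_of_real:
  fixes g :: "'a \<Rightarrow> real"
  assumes g: "continuous_on UNIV g"
  shows "T (\<lambda>y. of_real (g y)) x = of_real (Re (T (\<lambda>y. of_real (g y)) x))"
proof -
  have "bounded (range g)"
    using compact_continuous_image[OF g compact_carrier] by (rule compact_imp_bounded)
  then obtain B where B: "\<And>x. \<bar>g x\<bar> \<le> B" by (auto simp: bounded_iff)
  have gB: "0 \<le> g y + B" for y using B[of y] by linarith
  have "0 \<le> B" using B[of x] by linarith
  have "T (\<lambda>y. of_real (g y + B)) x \<in> \<real>\<^sub>\<ge>\<^sub>0" "T (\<lambda>y. of_real B) x \<in> \<real>\<^sub>\<ge>\<^sub>0"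
    using gB \<open>0 \<le> B\<close> g by (auto intro!: T_nonneg continuous_intros simp del: of_real_add)
  moreover have "T (\<lambda>y. of_real (g y + B)) x = T (\<lambda>y. of_real (g y)) x + T (\<lambda>y. of_real B) x"
    unfolding of_real_add by (intro T_add continuous_intros g)
  ultimately show ?thesis
    by (auto simp: complex_eq_iff complex_nonneg_Reals_iff)
qed

lemma positive_functional_T: "positive_functional (\<lambda>g. Re (T (\<lambda>y. of_real (g y)) x))"
proof
  show "Re (T (\<lambda>y. of_real (f y + g y)) x) = Re (T (\<lambda>y. of_real (f y)) x) + Re (T (\<lambda>y. of_real (g y)) x)"
    if "continuous_on UNIV f" "continuous_on UNIV g" for f g
    using that by (simp add: T_add continuous_on_of_real)
  show "Re (T (\<lambda>y. of_real (c * f y)) x) = c * Re (T (\<lambda>y. of_real (f y)) x)"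
    if "continuous_on UNIV f" for c f
    using that by (simp add: T_scale continuous_on_of_real)
  show "Re (T (\<lambda>y. of_real (f y)) x) \<ge> 0" if "continuous_on UNIV f" "\<And>x. f x \<ge> 0" for f
    using T_nonneg[of "\<lambda>y. of_real (f y)" x] that by (simp add: complex_nonneg_Reals_iff continuous_on_of_real)
qed

text \<open>The Riesz representation of the real part of \<open>T\<close> at \<open>x\<close> gives
  existence, and equality of real integrals gives uniqueness. Together they justify the definite
  description.\<close>

lemma fibre_measure:
  "regular_borel_measure (fibre_measure A x)"
  "(LINT y|fibre_measure A x. apply_bcontfun f y) = apply_bcontfun (A f) x"
proof -
  interpret P: positive_functional "\<lambda>g. Re (T (\<lambda>y. of_real (g y)) x)"
    by (rule positive_functional_T)
  let ?R = P.representing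
  note int = integrable_continuous[OF P.sets_representing P.finite_representing]
  let ?P = "\<lambda>M. regular_borel_measure M \<and>
       (\<forall>f. (LINT y|M. apply_bcontfun f y) = apply_bcontfun (A f) x)"
  have "?P ?R"
  proof (intro conjI allI)
    show "regular_borel_measure ?R"
      by (intro regular_borel_measureI P.sets_representing P.finite_representing)
    fix f :: "'a \<Rightarrow>\<^sub>C complex"
    define u where "u = (\<lambda>y. Re (apply_bcontfun f y))"
    define v where "v = (\<lambda>y. Im (apply_bcontfun f y))"
    have u: "continuous_on UNIV u" and v: "continuous_on UNIV v"
      unfolding u_def v_def by (intro continuous_intros continuous_on_apply_bcontfun)+
    have uc: "continuous_on UNIV (\<lambda>y. of_real (u y) :: complex)" "continuous_on UNIV (\<lambda>y. \<i> * of_real (v y))"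
      "continuous_on UNIV (\<lambda>y. of_real (v y) :: complex)"
      by (intro continuous_intros u v)+
    have f: "apply_bcontfun f = (\<lambda>y. of_real (u y) + \<i> * of_real (v y))"
      by (simp add: fun_eq_iff u_def v_def complex_eq_iff)
    have "(LINT y|?R. apply_bcontfun f y) = of_real (integral\<^sup>L ?R u) + \<i> * of_real (integral\<^sup>L ?R v)"
      unfolding f by (subst Bochner_Integration.integral_add) (auto intro: int uc)
    also have "\<dots> = T (\<lambda>y. of_real (u y)) x + \<i> * T (\<lambda>y. of_real (v y)) x"
      using T_of_real[OF u] T_of_real[OF v] by (simp add: P.integral_representing u v)
    also have "\<dots> = T (apply_bcontfun f) x"
      unfolding f by (simp only: T_add[OF uc(1,2)] T_scale[OF uc(3)])
    finally show "(LINT y|?R. apply_bcontfun f y) = apply_bcontfun (A f) x"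
      by (simp add: T_def apply_bcontfun_inverse)
  qed
  moreover have "M = ?R" if M: "?P M" for M
  proof (rule finite_borel_measure_eqI)
    fix g :: "'a \<Rightarrow> real" assume g: "continuous_on UNIV g"
    have gc: "apply_bcontfun (Bcontfun (\<lambda>y. complex_of_real (g y))) = (\<lambda>y. of_real (g y))"
      by (intro apply_Bcontfun_compact continuous_intros g)
    have "(LINT y|M. apply_bcontfun (Bcontfun (\<lambda>y. complex_of_real (g y))) y)
        = (LINT y|?R. apply_bcontfun (Bcontfun (\<lambda>y. complex_of_real (g y))) y)"
      using M \<open>?P ?R\<close> by simp
    then show "integral\<^sup>L M g = integral\<^sup>L ?R g"
      unfolding gc integral_complex_of_real of_real_eq_iff .
  qed (use M in \<open>auto simp: regular_borel_measure_def P.finite_representing\<close>)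
  ultimately have "?P (fibre_measure A x)"
    unfolding fibre_measure_def by (rule theI)
  then show "regular_borel_measure (fibre_measure A x)"
    "(LINT y|fibre_measure A x. apply_bcontfun f y) = apply_bcontfun (A f) x" by blast+
qed

abbreviation \<nu> :: "'a \<Rightarrow> 'a measure" where "\<nu> \<equiv> fibre_measure A"

lemma sets_nu [simp, measurable_cong]: "sets (\<nu> x) = sets borel"
  using fibre_measure(1)[of x] by (simp add: regular_borel_measure_def)

lemma space_nu [simp]: "space (\<nu> x) = UNIV"
  using sets_eq_imp_space_eq[OF sets_nu[of x]] by simp

lemma finite_nu: "finite_measure (\<nu> x)"
  using fibre_measure(1)[of x] by (simp add: regular_borel_measure_def)

lemma integrable_nu:
  fixes f :: "'a \<Rightarrow> 'b::{banach, second_countable_topology}"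
  shows "continuous_on UNIV f \<Longrightarrow> integrable (\<nu> x) f"
  by (rule integrable_continuous[OF sets_nu finite_nu])

lemma integral_nu: "continuous_on UNIV f \<Longrightarrow> integral\<^sup>L (\<nu> x) f = T f x"
  using fibre_measure(2)[of x "Bcontfun f"] by (simp add: T_def apply_Bcontfun_compact)

lemma continuous_integral_nu:
  fixes g :: "'a \<Rightarrow> real"
  assumes "continuous_on UNIV g"
  shows "continuous_on UNIV (\<lambda>x. integral\<^sup>L (\<nu> x) g)"
proof -
  have "integral\<^sup>L (\<nu> x) g = Re (T (\<lambda>y. of_real (g y)) x)" for x
    using integral_nu[of "\<lambda>y. of_real (g y)" x] assms
    by (simp add: continuous_on_of_real flip: integral_nu)
  then show ?thesis
    unfolding T_def by (simp add: continuous_intros continuous_on_apply_bcontfun)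
qed

text \<open>The homological identity for the function \<open>dist x\<close> turns the integral of
  \<open>dist x (\<alpha> y)\<close> into \<open>dist x x\<close> times the mass, which is
  \<open>0\<close>; the integrand is nonnegative.\<close>

lemma AE_nu: "AE y in \<nu> x. \<alpha> y = x"
proof -
  let ?d = "\<lambda>y. dist x (\<alpha> y)"
  have d: "continuous_on UNIV ?d" by (intro continuous_intros cont)
  have "(LINT y|\<nu> x. complex_of_real (?d y)) = T (\<lambda>y. of_real (dist x (\<alpha> y)) * 1) x"
    using integral_nu[of "\<lambda>y. of_real (?d y)" x] d by (simp add: continuous_on_of_real)
  also have "\<dots> = 0"
    by (subst T_homological[of "\<lambda>z. of_real (dist x z)"]) (auto intro!: continuous_intros)
  finally have "(LINT y|\<nu> x. ?d y) = 0" by simp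
  then have "AE y in \<nu> x. ?d y = 0"
    by (subst (asm) integral_nonneg_eq_0_iff_AE) (auto intro: integrable_nu d)
  then show ?thesis by (rule AE_mp) auto
qed

end

section \<open>Essential points and Birkhoff averages\<close>

lemma closed_essential_points: "closed (essential_points \<alpha>)"
proof -
  let ?N = "{V. open V \<and> (\<forall>\<mu>\<in>invariant_measures \<alpha>. \<not> measure \<mu> V > 0)}"
  have "- essential_points \<alpha> = \<Union> ?N"
    by (auto simp: essential_points_def)
  then show ?thesis by (auto simp: closed_def)
qed

lemma invariant_measureD:
  assumes "\<mu> \<in> invariant_measures \<alpha>"
  shows "sets \<mu> = sets borel" "prob_space \<mu>" "distr \<mu> borel \<alpha> = \<mu>" "space \<mu> = UNIV"
  using assms sets_eq_imp_space_eq[of \<mu> borel] by (auto simp: invariant_measures_def)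

text \<open>The complement is a union of open sets that are null for every invariant measure, and by
  Lindelof countably many of them suffice.\<close>

lemma essential_points_null:
  assumes mu: "\<mu> \<in> invariant_measures \<alpha>"
  shows "AE x in \<mu>. x \<in> essential_points \<alpha>"
proof -
  note D = invariant_measureD[OF mu]
  interpret prob_space \<mu> by (rule D)
  let ?N = "{V. open V \<and> (\<forall>\<mu>\<in>invariant_measures \<alpha>. \<not> measure \<mu> V > 0)}"
  have eq: "- essential_points \<alpha> = \<Union> ?N"
    by (auto simp: essential_points_def)
  obtain N' where N': "N' \<subseteq> ?N" "countable N'" "\<Union> N' = \<Union> ?N"
    using Lindelof[of ?N] by auto
  have "V \<in> null_sets \<mu>" if "V \<in> N'" for V
  proof (rule null_setsI)
    have V: "open V" "\<not> measure \<mu> V > 0" using N'(1) that mu by auto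
    then show "V \<in> sets \<mu>" by (simp add: D borel_open)
    show "emeasure \<mu> V = 0" using V(2) measure_nonneg[of \<mu> V] by (simp add: emeasure_eq_measure)
  qed
  then have "(\<Union>V\<in>N'. V) \<in> null_sets \<mu>"
    by (intro null_sets_UN' N')
  then have "- essential_points \<alpha> \<in> null_sets \<mu>" using N'(3) eq by simp
  then show ?thesis by (rule AE_I') auto
qed

lemma essential_points_invariant:
  assumes cont: "continuous_on UNIV \<alpha>" and x: "x \<in> essential_points \<alpha>"
  shows "\<alpha> x \<in> essential_points \<alpha>"
  unfolding essential_points_def
proof (intro CollectI allI impI)
  fix V assume V: "open V \<and> \<alpha> x \<in> V"
  then have "open (\<alpha> -` V)" "x \<in> \<alpha> -` V"
    using cont by (auto intro: open_vimage)
  then obtain \<mu> where mu: "\<mu> \<in> invariant_measures \<alpha>" "measure \<mu> (\<alpha> -` V) > 0"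
    using x unfolding essential_points_def by blast
  note D = invariant_measureD[OF mu(1)]
  have "\<alpha> \<in> measurable \<mu> borel"
    using borel_measurable_continuous_onI[OF cont] D(1) measurable_cong_sets by blast
  then have "measure (distr \<mu> borel \<alpha>) V = measure \<mu> (\<alpha> -` V)"
    using V by (simp add: measure_distr D(4))
  then show "\<exists>\<mu>\<in>invariant_measures \<alpha>. measure \<mu> V > 0"
    using mu D(3) by (intro bexI[of _ \<mu>]) simp_all
qed

lemma continuous_on_funpow:
  fixes f :: "'a::topological_space \<Rightarrow> 'a"
  assumes "continuous_on UNIV f"
  shows "continuous_on UNIV (f ^^ n)"
proof (induction n)
  case (Suc n)
  then show ?case
    using continuous_on_compose[of UNIV "f ^^ n" f] assms continuous_on_subset by (auto simp: o_def)
qed (simp add: id_def)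

lemma continuous_on_compact_bounded:
  fixes g :: "'a::compact_metric_space \<Rightarrow> real"
  assumes "continuous_on UNIV g"
  obtains B where "B > 0" "\<And>x. \<bar>g x\<bar> \<le> B"
proof -
  have "bounded (range g)"
    using compact_continuous_image[OF assms compact_carrier] by (rule compact_imp_bounded)
  then show ?thesis using that by (auto simp: bounded_pos)
qed

text \<open>Krylov--Bogolyubov, with a cluster point in a product of compact intervals in place of weak compactness.\<close>

lemma birkhoff_sum_small:
  fixes f :: "'a::compact_metric_space \<Rightarrow> real"
  assumes cont: "continuous_on UNIV \<alpha>" and f: "continuous_on UNIV f"
    and vanish: "\<And>x. x \<in> essential_points \<alpha> \<Longrightarrow> f x = 0" and \<eta>: "\<eta> > 0"
  shows "\<exists>N. \<forall>n\<ge>N. \<forall>x. (\<Sum>i<n. f ((\<alpha> ^^ i) x)) \<le> \<eta> * real n"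
proof (rule ccontr)
  assume "\<not> ?thesis"
  then have "\<exists>n x. n \<ge> Suc k \<and> (\<Sum>i<n. f ((\<alpha> ^^ i) x)) > \<eta> * real n" for k
    by (meson not_le_imp_less)
  then obtain m z where m: "\<And>k. m k \<ge> Suc k"
    and mz: "\<And>k. (\<Sum>i<m k. f ((\<alpha> ^^ i) (z k))) > \<eta> * real (m k)" by metis
  have m0: "real (m k) > 0" for k using m[of k] by simp
  let ?C = "continuous_on (UNIV :: 'a set)"
  \<comment> \<open>\<open>av k\<close> averages over the \<open>k\<close>-th segment. The value
    \<open>0\<close> on discontinuous functions keeps every coordinate bounded, so that all
    \<open>av k\<close> lie in a product of compact intervals.\<close>
  define av where "av = (\<lambda>k (g :: 'a \<Rightarrow> real). if ?C g then (\<Sum>i<m k. g ((\<alpha> ^^ i) (z k))) / m k else 0)"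
  define Bd where "Bd = (\<lambda>g :: 'a \<Rightarrow> real. if ?C g then (SOME B. \<forall>x. \<bar>g x\<bar> \<le> B) else 0)"
  have Bd: "\<bar>g x\<bar> \<le> Bd g" if "?C g" for g x
  proof -
    have "\<exists>B. \<forall>x. \<bar>g x\<bar> \<le> B" by (rule continuous_on_compact_bounded[OF that]) blast
    from someI_ex[OF this] show ?thesis using that by (simp add: Bd_def)
  qed
  define K where "K = (\<Pi>\<^sub>E g\<in>UNIV. {- Bd g .. Bd g})"
  have "compactin (product_topology (\<lambda>_. euclidean) UNIV) K"
    unfolding K_def compactin_PiE by (simp add: compactin_euclidean_iff)
  then have K: "compact K" by (simp add: euclidean_product_topology compactin_euclidean_iff)
  have avK: "av k \<in> K" for k
  proof -
    have "\<bar>av k g\<bar> \<le> Bd g" for g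
    proof (cases "?C g")
      case True
      have "\<bar>\<Sum>i<m k. g ((\<alpha> ^^ i) (z k))\<bar> \<le> (\<Sum>i<m k. Bd g)"
        by (rule order_trans[OF sum_abs]) (intro sum_mono Bd True)
      then show ?thesis using True m0[of k] by (simp add: av_def field_simps)
    qed (simp add: av_def Bd_def)
    then show ?thesis by (auto simp: K_def abs_le_iff minus_le_iff)
  qed
  \<comment> \<open>Compactness of \<open>K\<close> yields a cluster point \<open>L\<close>. The
    filter \<open>G\<close> joins the neighbourhoods of \<open>L\<close> with the tails of
    \<open>av\<close>: along it all coordinates converge, and whatever holds for all late
    \<open>k\<close> holds eventually.\<close>
  let ?F = "filtermap av sequentially"
  have "?F \<noteq> bot" by (simp add: filtermap_bot_iff)
  moreover have "eventually (\<lambda>l. l \<in> K) ?F" by (simp add: eventually_filtermap avK)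
  ultimately obtain L where G0: "inf (nhds L) ?F \<noteq> bot"
    using K unfolding compact_filter by blast
  define G where "G = inf (nhds L) ?F"
  have Gbot: "G \<noteq> bot" using G0 by (simp add: G_def)
  have lim: "((\<lambda>l. l g) \<longlongrightarrow> L g) G" for g
  proof -
    have "((\<lambda>l :: ('a \<Rightarrow> real) \<Rightarrow> real. l g) \<longlongrightarrow> L g) (nhds L)"
    proof (rule topological_tendstoI)
      fix S :: "real set" assume S: "open S" "L g \<in> S"
      have "open ((\<lambda>l :: ('a \<Rightarrow> real) \<Rightarrow> real. l g) -` S)"
        using S(1) by (intro open_vimage continuous_on_product_coordinates)
      then show "\<forall>\<^sub>F l in nhds L. l g \<in> S"
        using S(2) unfolding eventually_nhds by (intro exI[of _ "(\<lambda>l. l g) -` S"]) auto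
    qed
    then show ?thesis by (rule tendsto_mono[rotated]) (simp add: G_def)
  qed
  have ev: "eventually P G" if "\<forall>\<^sub>F k in sequentially. P (av k)" for P
    by (rule filter_leD[of G ?F]) (use that in \<open>simp_all add: G_def eventually_filtermap\<close>)
  have ev_le: "p \<le> q" if "(p' \<longlongrightarrow> p) G" "(q' \<longlongrightarrow> q) G" "\<forall>\<^sub>F k in sequentially. p' (av k) \<le> q' (av k)" for p q :: real and p' q'
    by (rule tendsto_le[OF Gbot that(2,1) ev[OF that(3)]])
  have ev_eq: "p = q" if "(p' \<longlongrightarrow> p) G" "(q' \<longlongrightarrow> q) G" "\<And>k. p' (av k) = q' (av k)" for p q :: real and p' q'
    using ev_le[OF that(1,2)] ev_le[OF that(2,1)] that(3) by (simp add: antisym)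
  interpret L: positive_functional L
  proof
    show "L (\<lambda>x. g x + h x) = L g + L h" if "?C g" "?C h" for g h
      by (rule ev_eq[OF lim tendsto_add[OF lim lim]])
        (use that in \<open>simp add: av_def continuous_on_add sum.distrib add_divide_distrib\<close>)
    show "L (\<lambda>x. c * g x) = c * L g" if "?C g" for c g
      by (rule ev_eq[OF lim tendsto_mult[OF tendsto_const lim]])
        (use that in \<open>simp add: av_def continuous_on_mult_left sum_distrib_left\<close>)
    show "L g \<ge> 0" if "?C g" "\<And>x. g x \<ge> 0" for g
      by (rule ev_le[OF tendsto_const lim])
        (use that in \<open>auto simp: av_def intro!: always_eventually divide_nonneg_nonneg sum_nonneg\<close>)
  qed
  have L1: "L (\<lambda>x. 1) = 1"
    by (rule ev_eq[OF lim tendsto_const]) (use m0 in \<open>simp add: av_def\<close>)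
  have Lf: "L f \<ge> \<eta>"
    by (rule ev_le[OF tendsto_const lim], rule always_eventually)
       (use mz m0 f in \<open>auto simp: av_def field_simps intro!: less_imp_le\<close>)
  \<comment> \<open>Shifting an orbit segment by one step changes its sum only by two boundary
    terms, at most \<open>2 * Bd g\<close>, which is negligible against \<open>m k\<close>.\<close>
  have inv: "L (\<lambda>x. g (\<alpha> x)) \<le> L g + e" if g: "?C g" and e: "e > 0" for g e
  proof (rule ev_le[OF lim tendsto_add[OF lim tendsto_const]])
    have ga: "?C (\<lambda>x. g (\<alpha> x))"
      using continuous_on_compose2[OF g cont] by simp
    obtain N :: nat where N: "real N * e > 2 * Bd g" using reals_Archimedean3[OF e] by blast
    have "av k (\<lambda>x. g (\<alpha> x)) \<le> av k g + e" if "k \<ge> N" for k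
    proof -
      have "(\<Sum>i<m k. g (\<alpha> ((\<alpha> ^^ i) (z k)))) + g (z k)
          = (\<Sum>i<m k. g ((\<alpha> ^^ i) (z k))) + g ((\<alpha> ^^ m k) (z k))"
        using sum.lessThan_Suc_shift[of "\<lambda>i. g ((\<alpha> ^^ i) (z k))" "m k"] by simp
      then have "(\<Sum>i<m k. g (\<alpha> ((\<alpha> ^^ i) (z k)))) \<le> (\<Sum>i<m k. g ((\<alpha> ^^ i) (z k))) + 2 * Bd g"
        using Bd[OF g, of "z k"] Bd[OF g, of "(\<alpha> ^^ m k) (z k)"] by linarith
      also have "2 * Bd g \<le> real (m k) * e"
      proof -
        have "real N \<le> real (m k)" using m[of k] that by simp
        then have "real N * e \<le> real (m k) * e" using e by simp
        then show ?thesis using N by linarith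
      qed
      finally show ?thesis using m0[of k] g ga by (simp add: av_def field_simps)
    qed
    then show "\<forall>\<^sub>F k in sequentially. av k (\<lambda>x. g (\<alpha> x)) \<le> av k g + e"
      by (auto simp: eventually_sequentially)
  qed
  have inv_le: "L (\<lambda>x. g (\<alpha> x)) \<le> L g" if "?C g" for g
    by (rule field_le_epsilon) (rule inv[OF that])
  have inv_eq: "L (\<lambda>x. g (\<alpha> x)) = L g" if g: "?C g" for g
  proof (rule antisym[OF inv_le[OF g]])
    have ga: "?C (\<lambda>x. g (\<alpha> x))" "?C (\<lambda>x. - g x)"
      using continuous_on_compose2[OF g cont] g by (auto intro: continuous_intros)
    have "L (\<lambda>x. - g (\<alpha> x)) \<le> L (\<lambda>x. - g x)" by (rule inv_le[OF ga(2)])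
    then show "L g \<le> L (\<lambda>x. g (\<alpha> x))"
      using L.scale[OF g, of "-1"] L.scale[OF ga(1), of "-1"] by simp
  qed
  let ?M = "L.representing"
  have meas: "\<alpha> \<in> measurable ?M borel"
    using borel_measurable_continuous_onI[OF cont] L.sets_representing measurable_cong_sets by blast
  interpret prob_space ?M
    by (intro prob_spaceI) (simp add: L.emeasure_representing L.outer_UNIV L1)
  have "distr ?M borel \<alpha> = ?M"
  proof (rule finite_borel_measure_eqI)
    show "finite_measure (distr ?M borel \<alpha>)" by (rule finite_measure_distr[OF meas])
    fix g :: "'a \<Rightarrow> real" assume g: "?C g"
    have "integral\<^sup>L (distr ?M borel \<alpha>) g = (LINT x|?M. g (\<alpha> x))"
      by (intro integral_distr meas borel_measurable_continuous_onI g)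
    also have "\<dots> = integral\<^sup>L ?M g"
      using continuous_on_compose2[OF g cont] g by (simp add: L.integral_representing inv_eq)
    finally show "integral\<^sup>L (distr ?M borel \<alpha>) g = integral\<^sup>L ?M g" .
  qed (simp_all add: L.finite_representing)
  then have "?M \<in> invariant_measures \<alpha>"
    by (simp add: invariant_measures_def prob_space_axioms)
  \<comment> \<open>The limiting measure is invariant and hence lives on the essential points, where
    \<open>f\<close> vanishes; yet its integral of \<open>f\<close> is at least \<eta>.\<close>
  then have "AE x in ?M. f x = 0"
    using essential_points_null vanish by fastforce
  then have "integral\<^sup>L ?M f = 0" by (rule integral_eq_zero_AE)
  then show False using Lf \<eta> L.integral_representing[OF f] by simp
qed

text \<open>Without essential points the constant \<open>1\<close> would vanish on all of them, and
  its averages would have to become small.\<close>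

lemma essential_points_nonempty:
  assumes "continuous_on UNIV \<alpha>"
  shows "essential_points \<alpha> \<noteq> {}"
proof
  assume "essential_points \<alpha> = {}"
  then obtain N where "\<forall>n\<ge>N. \<forall>x::'a. (\<Sum>i<n. 1) \<le> (1/2) * real n"
    using birkhoff_sum_small[OF assms continuous_on_const, of "1::real" "1/2"] by auto
  then have "(\<Sum>i<Suc N. 1) \<le> (1/2) * real (Suc N)" by (meson le_SucI order_refl)
  then show False by simp
qed

text \<open>Eventually the Birkhoff sum of \<open>f\<close> is at most \<open>\<eta> * n\<close>, so
  the damping costs at most \<open>exp (- t * \<eta> * n)\<close>. The choice of \<eta> spends half
  of the logarithmic gap between \<open>s\<close> and \<open>r\<close> on this; the other half
  absorbs \<open>C\<close>. Damping can thus be undone for an arbitrarily small increase of the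
  rate.\<close>

lemma damped_product_lower:
  fixes f :: "'a::compact_metric_space \<Rightarrow> real"
  assumes cont: "continuous_on UNIV \<alpha>" and f: "continuous_on UNIV f"
    and vanish: "\<And>x. x \<in> essential_points \<alpha> \<Longrightarrow> f x = 0"
    and t: "t > 0" and s: "s > 0" "s < r" and C: "C > 0"
  shows "\<exists>N. \<forall>n\<ge>N. \<forall>x. C * s ^ n \<le> r ^ n * (\<Prod>i<n. exp (- t * f ((\<alpha> ^^ i) x)))"
proof -
  define \<eta> where "\<eta> = ln (r / s) / (2 * t)"
  have rs: "r / s > 1" using s by simp
  then have \<eta>: "\<eta> > 0" using t by (simp add: \<eta>_def)
  define w where "w = exp (t * \<eta>) * s"
  have "t * \<eta> = ln (r / s) / 2" using t by (simp add: \<eta>_def)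
  also have "\<dots> < ln (r / s)" using rs ln_gt_zero[of "r / s"] by linarith
  finally have "exp (t * \<eta>) < exp (ln (r / s))" by simp
  then have w: "0 < w" "w < r" using s rs by (auto simp: w_def field_simps)
  obtain N1 where N1: "\<And>n x. n \<ge> N1 \<Longrightarrow> (\<Sum>i<n. f ((\<alpha> ^^ i) x)) \<le> \<eta> * real n"
    using birkhoff_sum_small[OF cont f vanish \<eta>] by blast
  have "(\<lambda>n. C * (w / r) ^ n) \<longlonglongrightarrow> C * 0"
    using w by (intro tendsto_intros LIMSEQ_realpow_zero) auto
  then have "\<forall>\<^sub>F n in sequentially. C * (w / r) ^ n < 1"
    by (rule order_tendstoD) simp
  then obtain N2 where N2: "\<And>n. n \<ge> N2 \<Longrightarrow> C * (w / r) ^ n < 1"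
    by (auto simp: eventually_sequentially)
  have "C * s ^ n \<le> r ^ n * (\<Prod>i<n. exp (- t * f ((\<alpha> ^^ i) x)))" if n: "n \<ge> max N1 N2" for n x
  proof -
    have "C * w ^ n \<le> r ^ n"
      using N2[of n] n w by (simp add: power_divide field_simps)
    then have "C * s ^ n \<le> r ^ n * exp (- (t * \<eta>)) ^ n"
      by (simp add: w_def power_mult_distrib exp_minus power_inverse field_simps)
    also have "exp (- (t * \<eta>)) ^ n = exp (- t * (\<eta> * real n))"
      by (simp add: exp_of_nat_mult[symmetric] mult.commute mult.left_commute)
    also have "\<dots> \<le> exp (- t * (\<Sum>i<n. f ((\<alpha> ^^ i) x)))"
      using N1[of n x] n t by simp
    also have "\<dots> = (\<Prod>i<n. exp (- t * f ((\<alpha> ^^ i) x)))"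
      by (simp add: exp_sum sum_distrib_left flip: sum_negf)
    finally show ?thesis using w by simp
  qed
  then show ?thesis by blast
qed

text \<open>The shares \<open>Z / r ^ m\<close> and \<open>1 - Z / r ^ m\<close> add up to
  \<open>1\<close>. This closes the inductions on orbit length, for operators and for covers alike,
  in which \<open>m\<close> steps or a single step are split off.\<close>

lemma geometric_recursion:
  fixes r Z C :: real
  assumes r: "r > 0" and n: "n = k + m" "n = Suc l"
  shows "Z * (C * r ^ k) + r * (1 - Z / r ^ m) * (C * r ^ l) = C * r ^ n"
proof -
  have "r ^ k * r ^ m = r ^ n" "r * r ^ l = r ^ n"
    unfolding n(1) by (simp add: power_add) (simp flip: n(1) add: n(2))
  then have "Z * (C * r ^ k) = C * r ^ n * (Z / r ^ m)" "r * (1 - Z / r ^ m) * (C * r ^ l) = C * r ^ n * (1 - Z / r ^ m)"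
    using r by (simp_all add: field_simps)
  then show ?thesis by (simp add: algebra_simps)
qed

section \<open>Growth of iterated integral operators\<close>

context transfer
begin

text \<open>The weighted operator in integral form on real functions. The weight is a parameter
  because damping replaces it.\<close>

definition Op :: "('a \<Rightarrow> real) \<Rightarrow> ('a \<Rightarrow> real) \<Rightarrow> 'a \<Rightarrow> real" where
  "Op u f x = (LINT y|\<nu> x. u y * f y)"

lemma continuous_Op:
  "continuous_on UNIV u \<Longrightarrow> continuous_on UNIV f \<Longrightarrow> continuous_on UNIV (Op u f)"
  unfolding Op_def[abs_def] by (intro continuous_integral_nu continuous_on_mult)

lemma continuous_Op_pow:
  assumes "continuous_on UNIV u" "continuous_on UNIV f"
  shows "continuous_on UNIV ((Op u ^^ n) f)"
  by (induction n) (simp_all add: assms continuous_Op)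

lemma Op_add:
  assumes "continuous_on UNIV u" "continuous_on UNIV f" "continuous_on UNIV g"
  shows "Op u (\<lambda>y. f y + g y) = (\<lambda>x. Op u f x + Op u g x)"
  unfolding Op_def distrib_left
  by (intro ext Bochner_Integration.integral_add integrable_nu continuous_on_mult assms)

lemma Op_scale: "Op u (\<lambda>y. c * f y) = (\<lambda>x. c * Op u f x)"
  unfolding Op_def by (simp add: mult.left_commute)

lemma Op_pow_add:
  assumes "continuous_on UNIV u" "continuous_on UNIV f" "continuous_on UNIV g"
  shows "(Op u ^^ n) (\<lambda>y. f y + g y) = (\<lambda>x. (Op u ^^ n) f x + (Op u ^^ n) g x)"
  by (induction n) (simp_all add: assms Op_add continuous_Op_pow)

lemma Op_pow_scale: "(Op u ^^ n) (\<lambda>y. c * f y) = (\<lambda>x. c * (Op u ^^ n) f x)"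
  by (induction n) (simp_all add: Op_scale)

lemma Op_mono:
  assumes "continuous_on UNIV u" "continuous_on UNIV v" "continuous_on UNIV f" "continuous_on UNIV g"
    and "\<And>y. u y * f y \<le> v y * g y"
  shows "Op u f x \<le> Op v g x"
  unfolding Op_def
  by (intro integral_mono integrable_nu continuous_on_mult assms)

lemma Op_pow_mono:
  assumes c: "continuous_on UNIV u" "continuous_on UNIV f" "continuous_on UNIV g"
    and u: "\<And>y. 0 \<le> u y" and fg: "\<And>y. f y \<le> g y"
  shows "(Op u ^^ n) f x \<le> (Op u ^^ n) g x"
proof (induction n arbitrary: x)
  case (Suc n)
  show ?case
    unfolding funpow.simps o_def
    by (intro Op_mono continuous_Op_pow c mult_left_mono Suc u)
qed (simp add: fg)

lemma Op_pow_nonneg: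
  assumes "continuous_on UNIV u" "continuous_on UNIV f" "\<And>y. 0 \<le> u y" "\<And>y. 0 \<le> f y"
  shows "0 \<le> (Op u ^^ n) f x"
  \<comment> \<open>Writing zero as the product \<open>0 * 0\<close> lets
    \<open>Op_pow_scale\<close> evaluate the iterate at the zero function.\<close>
  using Op_pow_mono[of u "\<lambda>_. 0 * 0" f n x] assms Op_pow_scale[of n u 0 "\<lambda>_. 0"] by simp

lemma Op_pow_mono_weight:
  assumes c: "continuous_on UNIV u" "continuous_on UNIV v" "continuous_on UNIV f"
    and u: "\<And>y. 0 \<le> u y" "\<And>y. u y \<le> v y" and f: "\<And>y. 0 \<le> f y"
  shows "(Op u ^^ n) f x \<le> (Op v ^^ n) f x"
proof (induction n arbitrary: x)
  case (Suc n)
  show ?case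
    unfolding funpow.simps o_def
    by (intro Op_mono continuous_Op_pow c mult_mono Suc u Op_pow_nonneg f order_trans[OF u])
qed simp

lemma Op_pow_const_bound:
  assumes u: "continuous_on UNIV u" "\<And>y. 0 \<le> u y" and B: "\<And>x. Op u (\<lambda>_. 1) x \<le> B" "0 \<le> B"
  shows "(Op u ^^ n) (\<lambda>_. 1) x \<le> B ^ n"
proof (induction n arbitrary: x)
  case (Suc n)
  have "(Op u ^^ Suc n) (\<lambda>_. 1) x = (Op u ^^ n) (Op u (\<lambda>_. 1)) x"
    by (simp add: funpow_swap1)
  also have "\<dots> \<le> (Op u ^^ n) (\<lambda>_. B * 1) x"
    using B by (intro Op_pow_mono u continuous_Op continuous_on_const) simp
  also have "\<dots> = B * (Op u ^^ n) (\<lambda>_. 1) x" by (simp only: Op_pow_scale)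
  also have "\<dots> \<le> B * B ^ n" using B(2) by (intro mult_left_mono Suc)
  finally show ?case by simp
qed simp

text \<open>Almost everywhere for the measure at \<open>x\<close> one has
  \<open>\<alpha> y = x\<close>, so the factor is constant under the integral.\<close>

lemma Op_compose_left:
  assumes c: "continuous_on UNIV u" "continuous_on UNIV p" "continuous_on UNIV g"
  shows "Op u (\<lambda>y. p (\<alpha> y) * g y) x = p x * Op u g x"
proof -
  have pa: "continuous_on UNIV (\<lambda>y. p (\<alpha> y))"
    using continuous_on_compose2[OF c(2) cont] by simp
  have m: "f \<in> borel_measurable (\<nu> x)" if "continuous_on UNIV f" for f :: "'a \<Rightarrow> real"
    using borel_measurable_continuous_onI[OF that] measurable_cong_sets[OF sets_nu[of x]] by blast
  have "(LINT y|\<nu> x. u y * (p (\<alpha> y) * g y)) = (LINT y|\<nu> x. p x * (u y * g y))"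
  proof (rule integral_cong_AE)
    show "AE y in \<nu> x. u y * (p (\<alpha> y) * g y) = p x * (u y * g y)"
      using AE_nu[of x] by eventually_elim (simp add: mult.left_commute)
  qed (intro m continuous_on_mult continuous_on_const c pa)+
  then show ?thesis by (simp add: Op_def)
qed

text \<open>All factors except the one at \<open>y\<close> itself depend only on
  \<open>\<alpha> y\<close> and leave the first integral by \<open>Op_compose_left\<close>. A
  product along the orbit is thereby absorbed into the weight, which links damped and undamped
  operators.\<close>

lemma Op_pow_prod:
  assumes u: "continuous_on UNIV u" and t: "continuous_on UNIV t" and w: "continuous_on UNIV w"
  shows "(Op u ^^ n) (\<lambda>y. (\<Prod>i<n. t ((\<alpha> ^^ i) y)) * w y) = (Op (\<lambda>y. u y * t y) ^^ n) w"
  using w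
proof (induction n arbitrary: w)
  case (Suc n)
  let ?P = "\<lambda>y. \<Prod>i<n. t ((\<alpha> ^^ i) y)"
  let ?v = "\<lambda>y. u y * t y"
  have P: "continuous_on UNIV ?P"
    by (intro continuous_on_prod continuous_on_compose2[OF t continuous_on_funpow[OF cont]]) auto
  have v: "continuous_on UNIV ?v" by (intro continuous_intros u t)
  have "(\<lambda>y. (\<Prod>i<Suc n. t ((\<alpha> ^^ i) y)) * w y) = (\<lambda>y. ?P (\<alpha> y) * (t y * w y))"
    by (subst prod.lessThan_Suc_shift) (simp add: funpow_swap1 fun_eq_iff)
  then have "Op u (\<lambda>y. (\<Prod>i<Suc n. t ((\<alpha> ^^ i) y)) * w y) = Op u (\<lambda>y. ?P (\<alpha> y) * (t y * w y))"
    by (rule arg_cong)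
  also have "\<dots> = (\<lambda>x. ?P x * Op u (\<lambda>y. t y * w y) x)"
    by (rule ext) (rule Op_compose_left[OF u P continuous_on_mult[OF t Suc.prems]])
  finally have "Op u (\<lambda>y. (\<Prod>i<Suc n. t ((\<alpha> ^^ i) y)) * w y) = (\<lambda>x. ?P x * Op u (\<lambda>y. t y * w y) x)" .
  also have "\<dots> = (\<lambda>x. ?P x * Op ?v w x)" by (simp add: Op_def mult.assoc)
  finally have step: "Op u (\<lambda>y. (\<Prod>i<Suc n. t ((\<alpha> ^^ i) y)) * w y) = (\<lambda>x. ?P x * Op ?v w x)" .
  have "(Op u ^^ Suc n) (\<lambda>y. (\<Prod>i<Suc n. t ((\<alpha> ^^ i) y)) * w y)
      = (Op u ^^ n) (\<lambda>x. ?P x * Op ?v w x)"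
    by (simp only: funpow_Suc_right o_def step)
  also have "\<dots> = (Op ?v ^^ n) (Op ?v w)"
    by (rule Suc.IH) (intro continuous_Op v Suc.prems)
  also have "\<dots> = (Op ?v ^^ Suc n) w" by (simp only: funpow_Suc_right o_def)
  finally show ?case .
qed simp

text \<open>The iterate is applied to \<open>1 = (1 - f) + f\<close>. On \<open>1 - f\<close> the
  first \<open>m\<close> applications cost a factor \<open>Z\<close>; on \<open>f\<close> one damped
  application costs at most \<open>q\<close>. With \<open>q = r * (1 - Z / r ^ m)\<close> the bound
  \<open>C * r ^ n\<close> reproduces itself.\<close>

lemma damped_growth:
  assumes u: "continuous_on UNIV u" "\<And>y. 0 \<le> u y"
    and f: "continuous_on UNIV f" "\<And>y. 0 \<le> f y" "\<And>y. f y \<le> 1"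
    and m: "m \<ge> 1" and Z: "\<And>x. (Op u ^^ m) (\<lambda>y. 1 - f y) x \<le> Z" and r: "r > 0" "Z < r ^ m"
  shows "\<exists>C t. C > 0 \<and> t > 0 \<and> (\<forall>n x. (Op (\<lambda>y. u y * exp (- t * f y)) ^^ n) (\<lambda>_. 1) x \<le> C * r ^ n)"
proof -
  have cf: "continuous_on UNIV (\<lambda>y. 1 - f y)" by (intro continuous_intros f)
  have Z0: "0 \<le> Z"
    using Op_pow_nonneg[OF u(1) cf u(2), of m undefined] Z[of undefined] f(3) by (simp add: order_trans)
  obtain B where B: "B > 0" "\<And>x. \<bar>Op u (\<lambda>_. 1) x\<bar> \<le> B"
    using continuous_on_compact_bounded[OF continuous_Op[OF u(1) continuous_on_const]] by blast
  define q where "q = r * (1 - Z / r ^ m)"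
  have q: "q > 0" using r by (simp add: q_def)
  \<comment> \<open>From \<open>t * f y \<le> exp (t * f y)\<close> the damped \<open>f\<close> is
    at most \<open>1 / t\<close>, so one step on \<open>f\<close> is bounded by
    \<open>B / t\<close>, which is \<open>q\<close> for this \<open>t\<close>.\<close>
  define t where "t = B / q"
  have t: "t > 0" using B q by (simp add: t_def)
  define v where "v = (\<lambda>y. u y * exp (- t * f y))"
  have v: "continuous_on UNIV v" "\<And>y. 0 \<le> v y"
    unfolding v_def using u by (auto intro!: continuous_intros f)
  have vu: "v y \<le> u y" for y
    unfolding v_def using u(2)[of y] f(2)[of y] t by (intro mult_right_le_one_le) auto
  have vf: "Op v f x \<le> q" for x
  proof -
    have "exp (- t * f y) * f y \<le> 1 / t" for y
    proof -
      have "t * f y \<le> exp (t * f y)" using exp_ge_add_one_self[of "t * f y"] by linarith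
      then have "exp (- t * f y) * (t * f y) \<le> exp (- t * f y) * exp (t * f y)"
        by (intro mult_left_mono) auto
      then show ?thesis using t by (simp add: exp_minus field_simps)
    qed
    then have "v y * f y \<le> u y * (1 / t * 1)" for y
      unfolding v_def mult.assoc mult_1_right by (intro mult_left_mono u)
    then have "Op v f x \<le> Op u (\<lambda>_. 1 / t * 1) x"
      by (intro Op_mono v u f continuous_on_const)
    also have "\<dots> = 1 / t * Op u (\<lambda>_. 1) x" by (simp only: Op_scale)
    also have "\<dots> \<le> 1 / t * B" using B(2)[of x] t by (intro mult_left_mono) auto
    also have "\<dots> = q" using B(1) by (simp add: t_def)
    finally show ?thesis .
  qed
  have vone: "Op v (\<lambda>_. 1) x \<le> B" for x
  proof -
    have "Op v (\<lambda>_. 1) x \<le> Op u (\<lambda>_. 1) x"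
      using vu by (intro Op_mono v u continuous_on_const) simp
    then show ?thesis using B(2)[of x] by linarith
  qed
  \<comment> \<open>Large enough for the base cases \<open>n < m\<close>, where only the crude bound
    \<open>B ^ n\<close> is available.\<close>
  define C where "C = 1 + (\<Sum>n<m. (B / r) ^ n)"
  have Br: "0 \<le> B / r" using B r by simp
  have C: "C > 0" unfolding C_def using Br by (intro add_pos_nonneg sum_nonneg) auto
  have "(Op v ^^ n) (\<lambda>_. 1) x \<le> C * r ^ n" for n x
  proof (induction n arbitrary: x rule: less_induct)
    case (less n)
    show ?case
    proof (cases "n < m")
      case True
      have "(Op v ^^ n) (\<lambda>_. 1) x \<le> B ^ n"
        using Op_pow_const_bound[OF v vone] B(1) by simp
      also have "\<dots> = (B / r) ^ n * r ^ n" using r by (simp add: power_divide)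
      also have "\<dots> \<le> C * r ^ n"
      proof (rule mult_right_mono)
        have "(B / r) ^ n \<le> (\<Sum>n<m. (B / r) ^ n)"
          using True Br by (intro member_le_sum) auto
        then show "(B / r) ^ n \<le> C" by (simp add: C_def)
      qed (use r in simp)
      finally show ?thesis .
    next
      case False
      then obtain k where k: "n = k + m" by (metis add.commute le_Suc_ex not_le)
      obtain l where l: "n = l + 1" using False m by (metis add.commute le_Suc_ex not_le order_trans)
      have "(Op v ^^ n) (\<lambda>_. 1) x = (Op v ^^ n) (\<lambda>y. (1 - f y) + f y) x" by simp
      also have "\<dots> = (Op v ^^ n) (\<lambda>y. 1 - f y) x + (Op v ^^ n) f x"
        by (simp only: Op_pow_add[OF v(1) cf f(1)])
      also have "(Op v ^^ n) (\<lambda>y. 1 - f y) x \<le> Z * (C * r ^ k)"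
      proof -
        have "(Op v ^^ n) (\<lambda>y. 1 - f y) x = (Op v ^^ k) ((Op v ^^ m) (\<lambda>y. 1 - f y)) x"
          by (simp add: k funpow_add)
        also have "\<dots> \<le> (Op v ^^ k) (\<lambda>_. Z * 1) x"
        proof (intro Op_pow_mono v continuous_Op_pow cf continuous_on_const)
          fix y
          have "(Op v ^^ m) (\<lambda>y. 1 - f y) y \<le> (Op u ^^ m) (\<lambda>y. 1 - f y) y"
            using f(3) by (intro Op_pow_mono_weight v u cf vu) simp
          then show "(Op v ^^ m) (\<lambda>y. 1 - f y) y \<le> Z * 1" using Z[of y] by simp
        qed
        also have "\<dots> = Z * (Op v ^^ k) (\<lambda>_. 1) x" by (simp only: Op_pow_scale)
        also have "\<dots> \<le> Z * (C * r ^ k)" using Z0 k m by (intro mult_left_mono less) auto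
        finally show ?thesis .
      qed
      also have "(Op v ^^ n) f x \<le> q * (C * r ^ l)"
      proof -
        have "(Op v ^^ n) f x = (Op v ^^ l) (Op v f) x"
          by (simp add: l funpow_swap1)
        also have "\<dots> \<le> (Op v ^^ l) (\<lambda>_. q * 1) x"
          using vf by (intro Op_pow_mono v continuous_Op f continuous_on_const) simp
        also have "\<dots> = q * (Op v ^^ l) (\<lambda>_. 1) x" by (simp only: Op_pow_scale)
        also have "\<dots> \<le> q * (C * r ^ l)" using q l by (intro mult_left_mono less) auto
        finally show ?thesis .
      qed
      also have "Z * (C * r ^ k) + q * (C * r ^ l) = C * r ^ n"
        unfolding q_def by (rule geometric_recursion) (use r k l in auto)
      finally show ?thesis by simp
    qed
  qed
  then show ?thesis using C t unfolding v_def by blast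
qed

text \<open>Since \<open>f\<close> vanishes at the essential points, the bound for the damped
  operator at rate \<open>s\<close> passes to the undamped one at any rate \<open>r > s\<close>: by
  \<open>damped_product_lower\<close> the constant \<open>1\<close> is dominated by a multiple of
  the damping product.\<close>

lemma growth_of_core:
  assumes u: "continuous_on UNIV u" "\<And>y. 0 \<le> u y"
    and f: "continuous_on UNIV f" "\<And>y. 0 \<le> f y" "\<And>y. f y \<le> 1"
    and vanish: "\<And>y. y \<in> essential_points \<alpha> \<Longrightarrow> f y = 0"
    and m: "m \<ge> 1" and Z: "\<And>x. (Op u ^^ m) (\<lambda>y. 1 - f y) x \<le> Z"
    and r: "s > 0" "Z < s ^ m" "s < r"
  shows "\<exists>N. \<forall>n\<ge>N. \<forall>x. (Op u ^^ n) (\<lambda>_. 1) x \<le> r ^ n"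
proof -
  obtain C t where C: "C > 0" and t: "t > 0"
    and bound: "\<And>n x. (Op (\<lambda>y. u y * exp (- t * f y)) ^^ n) (\<lambda>_. 1) x \<le> C * s ^ n"
    using damped_growth[OF u f m Z r(1,2)] by blast
  obtain N where N: "\<And>n x. n \<ge> N \<Longrightarrow> C * s ^ n \<le> r ^ n * (\<Prod>i<n. exp (- t * f ((\<alpha> ^^ i) x)))"
    using damped_product_lower[OF cont f(1) vanish t r(1,3) C] by blast
  have "(Op u ^^ n) (\<lambda>_. 1) x \<le> r ^ n" if n: "n \<ge> N" for n x
  proof -
    let ?P = "\<lambda>y. \<Prod>i<n. exp (- t * f ((\<alpha> ^^ i) y))"
    define c where "c = r ^ n / (C * s ^ n)"
    have c: "c \<ge> 0" using r C by (simp add: c_def)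
    have P: "continuous_on UNIV ?P"
      by (intro continuous_intros continuous_on_compose2[OF f(1) continuous_on_funpow[OF cont]]) auto
    have "1 \<le> c * (?P y * 1)" for y
      using N[OF n, of y] r C by (simp add: c_def field_simps)
    then have "(Op u ^^ n) (\<lambda>_. 1) x \<le> (Op u ^^ n) (\<lambda>y. c * (?P y * 1)) x"
      by (intro Op_pow_mono u continuous_on_mult continuous_on_const P)
    also have "\<dots> = c * (Op u ^^ n) (\<lambda>y. ?P y * 1) x"
      by (simp only: Op_pow_scale)
    also have "(Op u ^^ n) (\<lambda>y. ?P y * 1) = (Op (\<lambda>y. u y * exp (- t * f y)) ^^ n) (\<lambda>_. 1)"
      by (rule Op_pow_prod[of u "\<lambda>y. exp (- t * f y)"]) (intro continuous_intros u f)+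
    also have "c * (Op (\<lambda>y. u y * exp (- t * f y)) ^^ n) (\<lambda>_. 1) x \<le> c * (C * s ^ n)"
      by (intro mult_left_mono bound c)
    also have "\<dots> = r ^ n" using r C by (simp add: c_def)
    finally show ?thesis .
  qed
  then show ?thesis by blast
qed

end

section \<open>The operator restricted to the essential points\<close>

text \<open>The distance \<open>e\<close> is a Lebesgue number of the cover of \<open>S\<close> by
  open sets on which \<open>f\<close> is injective.\<close>

lemma local_homeomorphism_separates_fibres:
  fixes f :: "'a::metric_space \<Rightarrow> 'b::topological_space"
  assumes lh: "local_homeomorphism S T f" and S: "compact S"
  shows "\<exists>e>0. \<forall>x\<in>S. \<forall>y\<in>S. f x = f y \<longrightarrow> dist x y < e \<longrightarrow> x = y"
proof -
  let ?G = "{G. open G \<and> inj_on f (S \<inter> G)}"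
  have "S \<subseteq> \<Union> ?G"
  proof
    fix x assume "x \<in> S"
    then obtain U V g where U: "openin (top_of_set S) U" "x \<in> U" and g: "homeomorphism U V f g"
      using lh unfolding local_homeomorphism_def by blast
    obtain G where "open G" "U = S \<inter> G" using U(1) by (auto simp: openin_open)
    moreover have "inj_on f U"
      by (rule inj_on_inverseI[of U g]) (rule homeomorphism_apply1[OF g])
    ultimately show "x \<in> \<Union> ?G" using U(2) by blast
  qed
  then obtain e where e: "e > 0" "\<And>x. x \<in> S \<Longrightarrow> \<exists>G\<in>?G. ball x e \<subseteq> G"
    by (rule Heine_Borel_lemma[OF S]) blast+
  have "x = y" if xy: "x \<in> S" "y \<in> S" "f x = f y" "dist x y < e" for x y
  proof -
    obtain G where "inj_on f (S \<inter> G)" "ball x e \<subseteq> G" using e(2)[OF xy(1)] by blast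
    moreover have "x \<in> ball x e" "y \<in> ball x e" using e(1) xy(4) by auto
    ultimately show ?thesis using xy by (meson IntI inj_onD subsetD)
  qed
  then show ?thesis using e(1) by blast
qed

lemma compact_metric_finite_net:
  fixes e :: real
  assumes "e > 0"
  obtains K :: "'a::compact_metric_space set" where "finite K" "\<And>x. \<exists>y\<in>K. dist x y < e"
proof -
  have "\<exists>K. finite K \<and> (UNIV::'a set) \<subseteq> (\<Union>x\<in>K. ball x e)"
    using compact_carrier assms unfolding compact_eq_totally_bounded by blast
  then obtain K where "finite K" "(UNIV::'a set) \<subseteq> (\<Union>x\<in>K. ball x e)" by blast
  then show ?thesis by (intro that[of K]) (auto simp: dist_commute subset_iff)
qed

lemma compact_essential_points: "compact (essential_points \<alpha>)"
  using compact_Int_closed[OF compact_carrier closed_essential_points] by simp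

section \<open>Weighted sums over fibres inside the essential set\<close>

locale cocycle_transfer = transfer +
  fixes \<psi> \<rho> :: "'a \<Rightarrow> real"
  assumes lh: "local_homeomorphism (essential_points \<alpha>) (essential_points \<alpha>) \<alpha>"
    and \<psi>: "continuous_on UNIV \<psi>" and \<rho>: "continuous_on UNIV \<rho>" "\<And>x. \<rho> x > 0"
    and \<rho>_cocycle: "\<And>y. y \<in> essential_points \<alpha> \<Longrightarrow> \<rho> y = cocycle \<alpha> A y"
begin

abbreviation Y where "Y \<equiv> essential_points \<alpha>"
abbreviation B where "B \<equiv> Op (\<lambda>x. exp (\<psi> x))"

text \<open>On \<open>Y\<close> this is the fibre weight of the restricted operator. Off
  \<open>Y\<close> it depends on the chosen extension \<rho> and enters through the sums over
  spanning sets of \<open>X\<close>.\<close>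

definition a :: "'a \<Rightarrow> real" where "a x = exp (\<psi> x) * \<rho> x"

definition W :: "nat \<Rightarrow> 'a \<Rightarrow> real" where "W n x = (\<Prod>i<n. a ((\<alpha> ^^ i) x))"

text \<open>On \<open>Y\<close> this is the \<open>n\<close>-th iterate of the restricted operator
  at the constant \<open>1\<close>; off \<open>Y\<close> the sum is empty.\<close>

definition h :: "nat \<Rightarrow> 'a \<Rightarrow> real" where "h n x = (\<Sum>y\<in>{y\<in>Y. (\<alpha> ^^ n) y = x}. W n y)"

lemma a_pos: "a x > 0" by (simp add: a_def \<rho>)
lemma continuous_a: "continuous_on UNIV a"
  unfolding a_def[abs_def] by (intro continuous_intros \<psi> \<rho>)
lemma W_pos: "W n x > 0" unfolding W_def by (intro prod_pos) (simp add: a_pos)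

lemma continuous_weight: "continuous_on UNIV (\<lambda>x. exp (\<psi> x))"
  by (intro continuous_intros \<psi>)

lemma Y_funpow: "y \<in> Y \<Longrightarrow> (\<alpha> ^^ n) y \<in> Y"
  by (induction n) (auto intro: essential_points_invariant[OF cont])

lemma fibres_separated: "\<exists>e>0. \<forall>x\<in>Y. \<forall>y\<in>Y. \<alpha> x = \<alpha> y \<longrightarrow> dist x y < e \<longrightarrow> x = y"
  by (rule local_homeomorphism_separates_fibres[OF lh compact_essential_points])

text \<open>Two points of a fibre that share a net point are closer than the separation distance, so
  choosing net points is injective on the fibre.\<close>

lemma finite_fibre: "finite {y\<in>Y. \<alpha> y = x}"
proof -
  obtain e where e: "e > 0" "\<And>x y. x \<in> Y \<Longrightarrow> y \<in> Y \<Longrightarrow> \<alpha> x = \<alpha> y \<Longrightarrow> dist x y < e \<Longrightarrow> x = y"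
    using fibres_separated by blast
  obtain K :: "'a set" where K: "finite K" "\<And>x. \<exists>y\<in>K. dist x y < e / 2"
    using compact_metric_finite_net[of "e / 2"] e(1) by auto
  then obtain c where c: "\<And>x. c x \<in> K" "\<And>x. dist x (c x) < e / 2" by metis
  have "inj_on c {y\<in>Y. \<alpha> y = x}"
  proof (rule inj_onI)
    fix y z assume "y \<in> {y\<in>Y. \<alpha> y = x}" "z \<in> {y\<in>Y. \<alpha> y = x}" and eq: "c y = c z"
    moreover have "dist y z < e"
      using dist_triangle2[of y z "c y"] c(2)[of y] c(2)[of z] eq by simp
    ultimately show "y = z" using e(2) by simp
  qed
  then show ?thesis
    by (rule inj_on_finite[OF _ _ K(1)]) (use c(1) in auto)
qed

lemma fibre_Suc: "{y\<in>Y. (\<alpha> ^^ Suc n) y = x} = (\<Union>z\<in>{z\<in>Y. \<alpha> z = x}. {y\<in>Y. (\<alpha> ^^ n) y = z})"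
  using Y_funpow by auto

lemma finite_fibre_pow: "finite {y\<in>Y. (\<alpha> ^^ n) y = x}"
proof (induction n arbitrary: x)
  case 0
  have "{y\<in>Y. (\<alpha> ^^ 0) y = x} \<subseteq> {x}" by auto
  then show ?case using finite_subset by blast
next
  case (Suc n)
  then show ?case unfolding fibre_Suc by (intro finite_UN_I finite_fibre)
qed

lemma h_0: "h 0 x = indicator Y x"
proof -
  have "{y\<in>Y. y = x} = (if x \<in> Y then {x} else {})" by auto
  then show ?thesis by (simp add: h_def W_def)
qed

lemma h_outside: "x \<notin> Y \<Longrightarrow> h n x = 0"
  using Y_funpow by (auto simp: h_def intro!: sum.neutral)

lemma h_Suc: "h (Suc n) x = (\<Sum>z\<in>{z\<in>Y. \<alpha> z = x}. a z * h n z)"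
proof -
  have "h (Suc n) x = (\<Sum>z\<in>{z\<in>Y. \<alpha> z = x}. \<Sum>y\<in>{y\<in>Y. (\<alpha> ^^ n) y = z}. W (Suc n) y)"
    unfolding h_def fibre_Suc
    by (rule sum.UNION_disjoint[OF finite_fibre]) (auto intro: finite_fibre_pow)
  also have "\<dots> = (\<Sum>z\<in>{z\<in>Y. \<alpha> z = x}. a z * h n z)"
    unfolding h_def sum_distrib_left by (intro sum.cong refl) (auto simp: W_def mult.commute)
  finally show ?thesis .
qed

text \<open>The measure at \<open>x\<close> lives on the fibre over \<open>x\<close>, and
  \<open>g\<close> removes the part outside \<open>Y\<close>. What remains are finitely many atoms,
  whose masses are the values of the cocycle.\<close>

lemma integral_nu_core:
  assumes g[measurable]: "g \<in> borel_measurable borel" and out: "\<And>y. y \<notin> Y \<Longrightarrow> g y = 0"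
  shows "(LINT y|\<nu> x. exp (\<psi> y) * g y) = (\<Sum>z\<in>{z\<in>Y. \<alpha> z = x}. a z * g z)"
proof -
  let ?F = "{z\<in>Y. \<alpha> z = x}"
  interpret finite_measure "\<nu> x" by (rule finite_nu)
  have [measurable]: "(\<lambda>y. exp (\<psi> y)) \<in> borel_measurable borel"
    by (rule borel_measurable_continuous_onI[OF continuous_weight])
  have s[measurable]: "{z} \<in> sets (\<nu> x)" for z by simp
  have "(LINT y|\<nu> x. exp (\<psi> y) * g y) = (LINT y|\<nu> x. (\<Sum>z\<in>?F. exp (\<psi> z) * g z * indicator {z} y))"
  proof (rule integral_cong_AE)
    show "AE y in \<nu> x. exp (\<psi> y) * g y = (\<Sum>z\<in>?F. exp (\<psi> z) * g z * indicator {z} y)"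
      using AE_nu[of x]
    proof eventually_elim
      case (elim y)
      have "(\<Sum>z\<in>?F. exp (\<psi> z) * g z * indicator {z} y) = (\<Sum>z\<in>?F. if z = y then exp (\<psi> y) * g y else 0)"
        by (intro sum.cong) auto
      also have "\<dots> = exp (\<psi> y) * g y"
        using elim out by (auto simp: sum.delta'[OF finite_fibre] sum.delta[OF finite_fibre])
      finally show ?case by simp
    qed
  qed measurable
  also have "\<dots> = (\<Sum>z\<in>?F. (LINT y|\<nu> x. exp (\<psi> z) * g z * indicator {z} y))"
    by (intro Bochner_Integration.integral_sum integrable_mult_right integrable_real_indicator s)
       (simp add: emeasure_eq_measure)
  also have "\<dots> = (\<Sum>z\<in>?F. a z * g z)"
  proof (intro sum.cong refl)
    fix z assume z: "z \<in> ?F"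
    have "measure (\<nu> x) {z} = \<rho> z" using z \<rho>_cocycle by (auto simp: cocycle_def)
    then show "(LINT y|\<nu> x. exp (\<psi> z) * g z * indicator {z} y) = a z * g z"
      by (simp add: a_def)
  qed
  finally show ?thesis .
qed

text \<open>Dominated convergence with majorant
  \<open>exp (\<psi> y) * (B ^^ n) (\<lambda>_. 1) y\<close>. Measurability of \<open>h n\<close> is
  carried along because the next step integrates it.\<close>

lemma Op_pow_cutoff_tendsto:
  "h n \<in> borel_measurable borel \<and> (\<forall>x. (\<lambda>k. (B ^^ n) (cutoff Y k) x) \<longlonglongrightarrow> h n x)"
proof (induction n)
  case 0
  have "(\<lambda>k. cutoff Y k x) \<longlonglongrightarrow> h 0 x" for x
    unfolding h_0 by (rule cutoff_tendsto[OF closed_essential_points essential_points_nonempty[OF cont]])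
  moreover have "h 0 \<in> borel_measurable borel"
    unfolding h_0[abs_def] by (intro borel_measurable_indicator borel_closed closed_essential_points)
  ultimately show ?case by simp
next
  case (Suc n)
  let ?F = "\<lambda>k. (B ^^ n) (cutoff Y k)"
  have Fc: "continuous_on UNIV (?F k)" for k
    by (intro continuous_Op_pow continuous_weight continuous_on_cutoff)
  have F0: "0 \<le> ?F k y" and F1: "?F k y \<le> (B ^^ n) (\<lambda>_. 1) y" for k y
    by (auto intro!: Op_pow_nonneg Op_pow_mono continuous_weight continuous_on_cutoff)
  have lim: "(\<lambda>k. (B ^^ Suc n) (cutoff Y k) x) \<longlonglongrightarrow> h (Suc n) x" for x
  proof -
    have m: "f \<in> borel_measurable borel \<Longrightarrow> f \<in> borel_measurable (\<nu> x)" for f :: "'a \<Rightarrow> real"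
      using measurable_cong_sets[OF sets_nu[of x]] by blast
    have c1: "continuous_on UNIV ((B ^^ n) (\<lambda>_. 1))"
      by (intro continuous_Op_pow continuous_weight continuous_on_const)
    have "(\<lambda>k. LINT y|\<nu> x. exp (\<psi> y) * ?F k y) \<longlonglongrightarrow> (LINT y|\<nu> x. exp (\<psi> y) * h n y)"
    proof (rule integral_dominated_convergence)
      show "integrable (\<nu> x) (\<lambda>y. exp (\<psi> y) * (B ^^ n) (\<lambda>_. 1) y)"
        by (intro integrable_nu continuous_on_mult continuous_weight c1)
      show "(\<lambda>y. exp (\<psi> y) * h n y) \<in> borel_measurable (\<nu> x)"
        using Suc by (intro m borel_measurable_times borel_measurable_continuous_onI[OF continuous_weight]) simp
      show "(\<lambda>y. exp (\<psi> y) * ?F k y) \<in> borel_measurable (\<nu> x)" for k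
        by (intro m borel_measurable_continuous_onI continuous_on_mult continuous_weight Fc)
      show "AE y in \<nu> x. (\<lambda>k. exp (\<psi> y) * ?F k y) \<longlonglongrightarrow> exp (\<psi> y) * h n y"
        using Suc by (intro AE_I2 tendsto_mult tendsto_const) simp
      show "AE y in \<nu> x. norm (exp (\<psi> y) * ?F k y) \<le> exp (\<psi> y) * (B ^^ n) (\<lambda>_. 1) y" for k
        using F0 F1 by (intro AE_I2) (simp add: abs_mult)
    qed
    moreover have "(LINT y|\<nu> x. exp (\<psi> y) * h n y) = h (Suc n) x"
      unfolding h_Suc using Suc h_outside by (intro integral_nu_core) auto
    ultimately show ?thesis by (simp add: Op_def)
  qed
  moreover have "h (Suc n) \<in> borel_measurable borel"
    using lim by (rule borel_measurable_LIMSEQ_real)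
      (intro borel_measurable_continuous_onI continuous_Op_pow continuous_weight continuous_on_cutoff)
  ultimately show ?case by blast
qed

lemma h_le: "h n x \<le> (B ^^ n) (\<lambda>_. 1) x"
proof -
  have "(B ^^ n) (cutoff Y k) x \<le> (B ^^ n) (\<lambda>_. 1) x" for k
    by (intro Op_pow_mono continuous_weight continuous_on_cutoff continuous_on_const) auto
  moreover have "(\<lambda>k. (B ^^ n) (cutoff Y k) x) \<longlonglongrightarrow> h n x"
    using Op_pow_cutoff_tendsto by blast
  ultimately show ?thesis using LIMSEQ_le_const2 by blast
qed

lemma h_nonneg: "0 \<le> h n x"
  unfolding h_def using W_pos by (intro sum_nonneg) (auto intro: less_imp_le)

text \<open>The functions \<open>(B ^^ m) (cutoff Y k)\<close> decrease to \<open>h m\<close>, so by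
  Dini a single cutoff already obeys a bound just above \<open>Z\<close>;
  \<open>growth_of_core\<close> then applies to \<open>1 - cutoff Y k\<close>.\<close>

lemma operator_growth_le_core:
  assumes m: "m \<ge> 1" and Z: "\<And>x. h m x \<le> Z" and r: "r > 0" "Z < r ^ m"
  shows "\<exists>N. \<forall>n\<ge>N. \<forall>x. (B ^^ n) (\<lambda>_. 1) x \<le> r ^ n"
proof -
  have Z0: "0 \<le> Z" using h_nonneg Z order_trans by blast
  \<comment> \<open>Successive midpoints arrange \<open>Z < Z' < s ^ m < r ^ m\<close>: room for the
    cutoff and for undoing the damping.\<close>
  define s where "s = root m ((Z + r ^ m) / 2)"
  have sm: "s ^ m = (Z + r ^ m) / 2" using m Z0 r by (simp add: s_def)
  have s: "s > 0" unfolding s_def using m Z0 r by (simp add: add_nonneg_pos)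
  have "s ^ m < r ^ m" using sm r by simp
  then have sr: "s < r" by (rule power_less_imp_less_base) (use r in simp)
  define Z' where "Z' = (Z + s ^ m) / 2"
  have Z': "Z < Z'" "Z' < s ^ m" using r by (simp_all add: Z'_def sm)
  have "\<exists>k. \<forall>x. (B ^^ m) (cutoff Y k) x < Z'"
  proof (rule dini_upper)
    show "continuous_on UNIV ((B ^^ m) (cutoff Y k))" for k
      by (intro continuous_Op_pow continuous_weight continuous_on_cutoff)
    show "decseq (\<lambda>k. (B ^^ m) (cutoff Y k) x)" for x
      unfolding decseq_Suc_iff using cutoff_decseq
      by (intro allI Op_pow_mono continuous_weight continuous_on_cutoff) (auto simp: decseq_Suc_iff)
    fix x
    have "(\<lambda>k. (B ^^ m) (cutoff Y k) x) \<longlonglongrightarrow> h m x" using Op_pow_cutoff_tendsto by blast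
    then have "\<forall>\<^sub>F k in sequentially. (B ^^ m) (cutoff Y k) x < Z'"
      using Z[of x] Z'(1) by (intro order_tendstoD(2)[where y = "h m x"]) auto
    then show "\<exists>k. (B ^^ m) (cutoff Y k) x < Z'"
      by (auto simp: eventually_sequentially)
  qed
  then obtain k where k: "\<And>x. (B ^^ m) (cutoff Y k) x < Z'" by blast
  show ?thesis
  proof (rule growth_of_core[where f = "\<lambda>y. 1 - cutoff Y k y" and Z = Z' and s = s and m = m])
    show "continuous_on UNIV (\<lambda>y. 1 - cutoff Y k y)" by (intro continuous_intros)
    show "(B ^^ m) (\<lambda>y. 1 - (1 - cutoff Y k y)) x \<le> Z'" for x using k[of x] by simp
  qed (use m in \<open>simp_all add: continuous_weight cutoff_on s Z' sr less_imp_le\<close>)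
qed

text \<open>\<open>W n y\<close> is one term of \<open>h n\<close>. This keeps the operator norms
  from decaying faster than exponentially.\<close>

lemma operator_lower: "y \<in> Y \<Longrightarrow> W n y \<le> (B ^^ n) (\<lambda>_. 1) ((\<alpha> ^^ n) y)"
proof -
  assume y: "y \<in> Y"
  have "W n y \<le> h n ((\<alpha> ^^ n) y)"
    unfolding h_def using y W_pos finite_fibre_pow by (intro member_le_sum) (auto intro: less_imp_le)
  then show ?thesis using h_le order_trans by blast
qed

end

section \<open>Weighted covers and spanning sets\<close>

lemma dyn_dist_less_iff:
  "n \<ge> 1 \<Longrightarrow> dyn_dist \<alpha> n x y < e \<longleftrightarrow> (\<forall>i<n. dist ((\<alpha> ^^ i) x) ((\<alpha> ^^ i) y) < e)"
  unfolding dyn_dist_def by (subst Max_less_iff) (auto simp: lessThan_empty_iff)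

lemma uniform_orbit_continuity:
  fixes \<alpha> :: "'a::compact_metric_space \<Rightarrow> 'a"
  assumes cont: "continuous_on UNIV \<alpha>" and e: "e > 0"
  shows "\<exists>\<delta>>0. \<forall>x y. dist x y < \<delta> \<longrightarrow> (\<forall>i<n. dist ((\<alpha> ^^ i) x) ((\<alpha> ^^ i) y) < e)"
proof (induction n)
  case (Suc n)
  then obtain \<delta>1 where d1: "\<delta>1 > 0" "\<And>x y i. dist x y < \<delta>1 \<Longrightarrow> i < n \<Longrightarrow> dist ((\<alpha> ^^ i) x) ((\<alpha> ^^ i) y) < e"
    by blast
  have "uniformly_continuous_on UNIV (\<alpha> ^^ n)"
    by (intro compact_uniformly_continuous continuous_on_funpow cont compact_carrier)
  then obtain \<delta>2 where d2: "\<delta>2 > 0" "\<And>x y. dist x y < \<delta>2 \<Longrightarrow> dist ((\<alpha> ^^ n) x) ((\<alpha> ^^ n) y) < e"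
    using e unfolding uniformly_continuous_on_def by (metis UNIV_I dist_commute)
  show ?case
    by (rule exI[of _ "min \<delta>1 \<delta>2"]) (use d1 d2 in \<open>auto simp: less_Suc_eq\<close>)
qed (use e in auto)

lemma powr_inverse_le_iff:
  fixes x r :: real
  assumes "n \<ge> 1" "x \<ge> 0" "r > 0"
  shows "x powr (1 / real n) \<le> r \<longleftrightarrow> x \<le> r ^ n"
proof (cases "x = 0")
  case False
  have "root n x \<le> r \<longleftrightarrow> root n x \<le> root n (r ^ n)"
    using assms by (simp add: real_root_power_cancel)
  also have "\<dots> \<longleftrightarrow> x \<le> r ^ n" using assms by (simp add: real_root_le_iff)
  finally show ?thesis using assms False root_powr_inverse[of n x] by simp
qed (use assms in simp)

lemma powr_inverse_less_iff:
  fixes x r :: real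
  assumes "n \<ge> 1" "x \<ge> 0" "r > 0"
  shows "x powr (1 / real n) < r \<longleftrightarrow> x < r ^ n"
proof (cases "x = 0")
  case False
  have "root n x < r \<longleftrightarrow> root n x < root n (r ^ n)"
    using assms by (simp add: real_root_power_cancel)
  also have "\<dots> \<longleftrightarrow> x < r ^ n" using assms by (simp add: real_root_less_iff)
  finally show ?thesis using assms False root_powr_inverse[of n x] by simp
qed (use assms in simp)

text \<open>Each pair holds a set of initial points that stay \<delta>-close to each other for
  \<open>n\<close> steps, and a bound for their orbit products. Bounds are stored, not values at a
  chosen point, because bounds multiply under concatenation. The quantified closeness also covers
  \<open>n = 0\<close>.\<close>

definition orbit_family ::
    "('a::metric_space \<Rightarrow> 'a) \<Rightarrow> ('a \<Rightarrow> real) \<Rightarrow> real \<Rightarrow> nat \<Rightarrow> ('a set \<times> real) set \<Rightarrow> bool" where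
  "orbit_family \<alpha> v \<delta> n J \<longleftrightarrow> finite J \<and>
     (\<forall>j\<in>J. 0 \<le> snd j \<and> (\<forall>x\<in>fst j. (\<Prod>k<n. v ((\<alpha> ^^ k) x)) \<le> snd j) \<and>
        (\<forall>x\<in>fst j. \<forall>y\<in>fst j. \<forall>k<n. dist ((\<alpha> ^^ k) x) ((\<alpha> ^^ k) y) < \<delta>))"

lemma orbit_familyD:
  assumes "orbit_family \<alpha> v \<delta> n J"
  shows "finite J"
    and "\<And>j. j \<in> J \<Longrightarrow> 0 \<le> snd j"
    and "\<And>j x. j \<in> J \<Longrightarrow> x \<in> fst j \<Longrightarrow> (\<Prod>k<n. v ((\<alpha> ^^ k) x)) \<le> snd j"
    and "\<And>j x y k. j \<in> J \<Longrightarrow> x \<in> fst j \<Longrightarrow> y \<in> fst j \<Longrightarrow> k < n \<Longrightarrow> dist ((\<alpha> ^^ k) x) ((\<alpha> ^^ k) y) < \<delta>"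
  using assms unfolding orbit_family_def by blast+

text \<open>Unlike spanning sets, such covers can be concatenated in time without loss in \<open>\<delta>\<close>.\<close>

definition weighted_cover ::
    "('a::metric_space \<Rightarrow> 'a) \<Rightarrow> ('a \<Rightarrow> real) \<Rightarrow> real \<Rightarrow> 'a set \<Rightarrow> nat \<Rightarrow> real \<Rightarrow> bool" where
  "weighted_cover \<alpha> v \<delta> S n K \<longleftrightarrow>
     (\<exists>J. orbit_family \<alpha> v \<delta> n J \<and> S \<subseteq> (\<Union>j\<in>J. fst j) \<and> (\<Sum>j\<in>J. snd j) \<le> K)"

text \<open>Indices that yield the same pair are merged; as the bounds are nonnegative, merging can
  only lower the sum.\<close>

lemma weighted_coverI:
  assumes I: "finite I" "S \<subseteq> (\<Union>i\<in>I. V i)"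
    and c: "\<And>i. i \<in> I \<Longrightarrow> 0 \<le> c i" "\<And>i x. i \<in> I \<Longrightarrow> x \<in> V i \<Longrightarrow> (\<Prod>k<n. v ((\<alpha> ^^ k) x)) \<le> c i"
    and d: "\<And>i x y k. i \<in> I \<Longrightarrow> x \<in> V i \<Longrightarrow> y \<in> V i \<Longrightarrow> k < n \<Longrightarrow> dist ((\<alpha> ^^ k) x) ((\<alpha> ^^ k) y) < \<delta>"
    and K: "(\<Sum>i\<in>I. c i) \<le> K"
  shows "weighted_cover \<alpha> v \<delta> S n K"
  unfolding weighted_cover_def
proof (intro exI[of _ "(\<lambda>i. (V i, c i)) ` I"] conjI)
  have "(\<Sum>j\<in>(\<lambda>i. (V i, c i)) ` I. snd j) \<le> (\<Sum>i\<in>I. (snd \<circ> (\<lambda>i. (V i, c i))) i)"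
    using c(1) by (intro sum_image_le I) auto
  then show "(\<Sum>j\<in>(\<lambda>i. (V i, c i)) ` I. snd j) \<le> K" using K by simp
  show "orbit_family \<alpha> v \<delta> n ((\<lambda>i. (V i, c i)) ` I)"
    unfolding orbit_family_def using I(1) c d by auto
qed (use I in auto)

lemma weighted_cover_mono:
  "weighted_cover \<alpha> v \<delta> S n K \<Longrightarrow> K \<le> K' \<Longrightarrow> weighted_cover \<alpha> v \<delta> S n K'"
  unfolding weighted_cover_def by (meson order_trans)

lemma weighted_cover_0: "weighted_cover \<alpha> v \<delta> S 0 1"
  by (rule weighted_coverI[of "{()}" S "\<lambda>_. UNIV" "\<lambda>_. 1"]) auto

lemma weighted_cover_Un:
  assumes "weighted_cover \<alpha> v \<delta> S n K" "weighted_cover \<alpha> v \<delta> S' n K'"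
  shows "weighted_cover \<alpha> v \<delta> (S \<union> S') n (K + K')"
proof -
  obtain J where F: "orbit_family \<alpha> v \<delta> n J" "S \<subseteq> (\<Union>j\<in>J. fst j)" "(\<Sum>j\<in>J. snd j) \<le> K"
    using assms(1) unfolding weighted_cover_def by blast
  note J = orbit_familyD(1)[OF F(1)] F(2) orbit_familyD(2-4)[OF F(1)] F(3)
  obtain J' where F': "orbit_family \<alpha> v \<delta> n J'" "S' \<subseteq> (\<Union>j\<in>J'. fst j)" "(\<Sum>j\<in>J'. snd j) \<le> K'"
    using assms(2) unfolding weighted_cover_def by blast
  note J' = orbit_familyD(1)[OF F'(1)] F'(2) orbit_familyD(2-4)[OF F'(1)] F'(3)
  show ?thesis
  proof (rule weighted_coverI[where I = "J \<union> J'" and V = fst and c = snd])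
    have "(\<Sum>j\<in>J \<union> J'. snd j) \<le> (\<Sum>j\<in>J. snd j) + (\<Sum>j\<in>J'. snd j)"
      using J(1,3) J'(1,3) by (subst sum.union_inter[symmetric]) (auto intro!: sum_nonneg)
    then show "(\<Sum>j\<in>J \<union> J'. snd j) \<le> K + K'" using J(6) J'(6) by linarith
  qed (use J J' in auto)
qed

text \<open>Sets of the first cover are intersected with preimages under
  \<open>\<alpha> ^^ m\<close> of sets of the second, and the bounds multiply. The second cover must
  be of the whole space, since the orbit may be anywhere after \<open>m\<close> steps.\<close>

lemma weighted_cover_concat:
  assumes "weighted_cover \<alpha> v \<delta> S m K" "weighted_cover \<alpha> v \<delta> UNIV n K'"
    and v: "\<And>x. 0 \<le> v x"
  shows "weighted_cover \<alpha> v \<delta> S (m + n) (K * K')"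
proof -
  obtain J where F: "orbit_family \<alpha> v \<delta> m J" "S \<subseteq> (\<Union>j\<in>J. fst j)" "(\<Sum>j\<in>J. snd j) \<le> K"
    using assms(1) unfolding weighted_cover_def by blast
  note J = orbit_familyD(1)[OF F(1)] F(2) orbit_familyD(2-4)[OF F(1)] F(3)
  obtain J' where F': "orbit_family \<alpha> v \<delta> n J'" "UNIV \<subseteq> (\<Union>j\<in>J'. fst j)" "(\<Sum>j\<in>J'. snd j) \<le> K'"
    using assms(2) unfolding weighted_cover_def by blast
  note J' = orbit_familyD(1)[OF F'(1)] F'(2) orbit_familyD(2-4)[OF F'(1)] F'(3)
  let ?V = "\<lambda>(i, j). fst i \<inter> (\<alpha> ^^ m) -` fst j"
  let ?c = "\<lambda>(i, j). snd i * snd j"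
  have pow: "(\<alpha> ^^ (m + k)) x = (\<alpha> ^^ k) ((\<alpha> ^^ m) x)" for k x
    by (simp add: funpow_add add.commute[of m])
  show ?thesis
  proof (rule weighted_coverI[where I = "J \<times> J'" and V = ?V and c = ?c])
    show "finite (J \<times> J')" using J(1) J'(1) by simp
    show "S \<subseteq> (\<Union>p\<in>J \<times> J'. ?V p)"
    proof
      fix x assume "x \<in> S"
      then obtain i where "i \<in> J" "x \<in> fst i" using J(2) by blast
      moreover obtain j where "j \<in> J'" "(\<alpha> ^^ m) x \<in> fst j" using J'(2) by blast
      ultimately show "x \<in> (\<Union>p\<in>J \<times> J'. ?V p)" by (intro UN_I[of "(i, j)"]) auto
    qed
    show "0 \<le> ?c p" if "p \<in> J \<times> J'" for p using that J(3) J'(3) by (auto split: prod.split)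
    show "(\<Prod>k<m + n. v ((\<alpha> ^^ k) x)) \<le> ?c p" if p: "p \<in> J \<times> J'" "x \<in> ?V p" for p x
    proof -
      obtain i j where ij: "p = (i, j)" "i \<in> J" "j \<in> J'" "x \<in> fst i" "(\<alpha> ^^ m) x \<in> fst j"
        using p by auto
      have "(\<Prod>k<m + n. v ((\<alpha> ^^ k) x)) = (\<Prod>k<m. v ((\<alpha> ^^ k) x)) * (\<Prod>k<n. v ((\<alpha> ^^ k) ((\<alpha> ^^ m) x)))"
        by (induction n) (simp_all only: add_0_right add_Suc_right prod.lessThan_Suc pow mult.assoc
            lessThan_0 prod.empty mult_1_right)
      also have "\<dots> \<le> snd i * snd j"
        using ij by (intro mult_mono J J' prod_nonneg v ballI)
      finally show ?thesis by (simp add: ij)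
    qed
    show "dist ((\<alpha> ^^ k) x) ((\<alpha> ^^ k) y) < \<delta>"
      if p: "p \<in> J \<times> J'" "x \<in> ?V p" "y \<in> ?V p" and k: "k < m + n" for p x y k
    proof (cases "k < m")
      case True
      then show ?thesis using p by (auto intro: J(5))
    next
      case False
      then obtain l where l: "k = m + l" by (metis le_Suc_ex not_le)
      with k have "l < n" by simp
      then show ?thesis using p unfolding l pow by (auto intro: J'(5))
    qed
    have "(\<Sum>p\<in>J \<times> J'. ?c p) = (\<Sum>j\<in>J. snd j) * (\<Sum>j\<in>J'. snd j)"
      by (simp add: sum_product sum.cartesian_product)
    also have "\<dots> \<le> K * K'"
    proof (rule mult_mono[OF J(6) J'(6)])
      have "0 \<le> (\<Sum>j\<in>J. snd j)" by (intro sum_nonneg J(3))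
      then show "0 \<le> K" using J(6) by linarith
      show "0 \<le> (\<Sum>j\<in>J'. snd j)" by (intro sum_nonneg J'(3))
    qed
    finally show "(\<Sum>p\<in>J \<times> J'. ?c p) \<le> K * K'" .
  qed
qed

lemma weighted_cover_power:
  assumes "weighted_cover \<alpha> v \<delta> UNIV 1 K" "\<And>x. 0 \<le> v x"
  shows "weighted_cover \<alpha> v \<delta> UNIV n (K ^ n)"
proof (induction n)
  case (Suc n)
  show ?case using weighted_cover_concat[OF assms(1) Suc assms(2)] by simp
qed (simp add: weighted_cover_0)

text \<open>The counterpart of \<open>damped_growth\<close>: orbits starting in \<open>U\<close>
  take \<open>m\<close> steps at cost \<open>Z\<close>, all others one step at the complementary
  cost. The constant \<open>C\<close> again handles \<open>n < m\<close>.\<close>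

lemma weighted_cover_growth:
  assumes core: "weighted_cover \<alpha> v \<delta> U m Z" and rest: "weighted_cover \<alpha> v \<delta> (- U) 1 (r * (1 - Z / r ^ m))"
    and all: "weighted_cover \<alpha> v \<delta> UNIV 1 K" and K: "K > 0" and v: "\<And>x. 0 \<le> v x"
    and m: "m \<ge> 1" and r: "r > 0"
  shows "\<exists>C>0. \<forall>n. weighted_cover \<alpha> v \<delta> UNIV n (C * r ^ n)"
proof -
  define C where "C = 1 + (\<Sum>n<m. (K / r) ^ n)"
  have Kr: "0 \<le> K / r" using K r by simp
  have C: "C > 0" unfolding C_def using Kr by (intro add_pos_nonneg sum_nonneg) auto
  have "weighted_cover \<alpha> v \<delta> UNIV n (C * r ^ n)" for n
  proof (induction n rule: less_induct)
    case (less n)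
    show ?case
    proof (cases "n < m")
      case True
      have "(K / r) ^ n \<le> (\<Sum>n<m. (K / r) ^ n)"
        using True Kr by (intro member_le_sum) auto
      then have "(K / r) ^ n * r ^ n \<le> C * r ^ n" using r by (intro mult_right_mono) (auto simp: C_def)
      then have "K ^ n \<le> C * r ^ n" using r by (simp add: power_divide)
      with weighted_cover_power[OF all v] show ?thesis by (rule weighted_cover_mono)
    next
      case False
      then obtain k where k: "n = m + k" by (metis le_Suc_ex not_le)
      obtain l where l: "n = 1 + l" using False m by (metis le_Suc_ex not_le order_trans)
      have "weighted_cover \<alpha> v \<delta> U n (Z * (C * r ^ k))"
        unfolding k by (intro weighted_cover_concat core less v) (use k m in simp)
      moreover have "weighted_cover \<alpha> v \<delta> (- U) n (r * (1 - Z / r ^ m) * (C * r ^ l))"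
        unfolding l by (intro weighted_cover_concat rest less v) (use l in simp)
      ultimately have "weighted_cover \<alpha> v \<delta> (U \<union> - U) n
          (Z * (C * r ^ k) + r * (1 - Z / r ^ m) * (C * r ^ l))"
        by (rule weighted_cover_Un)
      then show ?thesis
        using geometric_recursion[OF r, of n k m l Z C] k l by simp
    qed
  qed
  then show ?thesis using C by blast
qed

text \<open>One point from each nonempty set of the cover suffices. The comparison of
  \<open>w\<close> with the product of \<open>v\<close> leaves room for removing the damping from
  the weight.\<close>

lemma weighted_cover_spanning:
  assumes "weighted_cover \<alpha> v \<delta> UNIV n K" and n: "n \<ge> 1"
    and c: "c \<ge> 0" "\<And>x. w x \<le> c * (\<Prod>i<n. v ((\<alpha> ^^ i) x))" "\<And>x. w x \<ge> 0"
  shows "\<exists>E. finite E \<and> spanning \<alpha> n \<delta> UNIV E \<and> (\<Sum>y\<in>E. w y) \<le> c * K"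
proof -
  obtain J where F: "orbit_family \<alpha> v \<delta> n J" "UNIV \<subseteq> (\<Union>j\<in>J. fst j)" "(\<Sum>j\<in>J. snd j) \<le> K"
    using assms(1) unfolding weighted_cover_def by blast
  note J = orbit_familyD(1)[OF F(1)] F(2) orbit_familyD(2-4)[OF F(1)] F(3)
  let ?J = "{j\<in>J. fst j \<noteq> {}}"
  let ?p = "\<lambda>j. SOME x. x \<in> fst j"
  have p: "?p j \<in> fst j" if "j \<in> ?J" for j
    using that some_in_eq by blast
  have fin: "finite ?J" using J(1) by simp
  have "spanning \<alpha> n \<delta> UNIV (?p ` ?J)"
    unfolding spanning_def dyn_dist_less_iff[OF n]
  proof (intro conjI ballI subset_UNIV)
    fix x
    obtain j where j: "j \<in> J" "x \<in> fst j" using J(2) by blast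
    then have "j \<in> ?J" by auto
    then show "\<exists>y\<in>?p ` ?J. \<forall>i<n. dist ((\<alpha> ^^ i) x) ((\<alpha> ^^ i) y) < \<delta>"
      using j p[of j] J(5) by blast
  qed
  moreover have "(\<Sum>y\<in>?p ` ?J. w y) \<le> c * K"
  proof -
    have "(\<Sum>y\<in>?p ` ?J. w y) \<le> (\<Sum>j\<in>?J. (w \<circ> ?p) j)"
      by (rule sum_image_le[OF fin]) (rule c)
    also have "\<dots> \<le> (\<Sum>j\<in>?J. c * snd j)"
    proof (intro sum_mono)
      fix j assume j: "j \<in> ?J"
      then have "c * (\<Prod>i<n. v ((\<alpha> ^^ i) (?p j))) \<le> c * snd j"
        using p[OF j] by (intro mult_left_mono J c) auto
      then show "(w \<circ> ?p) j \<le> c * snd j" using c(2)[of "?p j"] by simp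
    qed
    also have "\<dots> \<le> (\<Sum>j\<in>J. c * snd j)"
      using J(1,3) c(1) by (intro sum_mono2) auto
    also have "\<dots> \<le> c * K"
      unfolding sum_distrib_left[symmetric] using J(6) c(1) by (rule mult_left_mono)
    finally show ?thesis .
  qed
  ultimately show ?thesis using fin by (intro exI[of _ "?p ` ?J"]) simp
qed

section \<open>Spanning sets of the essential set and of the whole space\<close>

context cocycle_transfer
begin

text \<open>Backwards in time: orbits that agree at one time and are close one step earlier agree
  there too, by the separation of fibres.\<close>

lemma core_orbit_separated:
  assumes e: "\<And>x y. x \<in> Y \<Longrightarrow> y \<in> Y \<Longrightarrow> \<alpha> x = \<alpha> y \<Longrightarrow> dist x y < e \<Longrightarrow> x = y"
    and "x \<in> Y" "y \<in> Y" "(\<alpha> ^^ n) x = (\<alpha> ^^ n) y" "\<And>i. i < n \<Longrightarrow> dist ((\<alpha> ^^ i) x) ((\<alpha> ^^ i) y) < e"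
  shows "x = y"
  using assms(4,5)
proof (induction n)
  case (Suc n)
  have "(\<alpha> ^^ n) x = (\<alpha> ^^ n) y"
    by (rule e) (use Suc.prems assms(2,3) Y_funpow in simp_all)
  then show ?case using Suc by simp
qed simp

lemma W_le:
  assumes c: "\<And>x y. dist x y < \<delta> \<Longrightarrow> a x \<le> c * a y"
    and d: "\<And>i. i < n \<Longrightarrow> dist ((\<alpha> ^^ i) x) ((\<alpha> ^^ i) y) < \<delta>"
  shows "W n x \<le> c ^ n * W n y"
proof -
  have "W n x \<le> (\<Prod>i<n. c * a ((\<alpha> ^^ i) y))"
    unfolding W_def by (intro prod_mono conjI c d less_imp_le[OF a_pos]) simp
  then show ?thesis by (simp add: W_def prod.distrib)
qed

text \<open>Each fibre point is sent to a shadowing point of \<open>E\<close>. Two fibre points with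
  the same shadow stay within \<open>2 * \<epsilon>\<close>, so they coincide by
  \<open>core_orbit_separated\<close>; replacing weights along the orbits costs
  \<open>c ^ n\<close>.\<close>

lemma h_le_spanning_sum:
  assumes e: "\<And>x y. x \<in> Y \<Longrightarrow> y \<in> Y \<Longrightarrow> \<alpha> x = \<alpha> y \<Longrightarrow> dist x y < 2 * \<epsilon> \<Longrightarrow> x = y"
    and c: "\<And>x y. dist x y < \<epsilon> \<Longrightarrow> a x \<le> c * a y" "c \<ge> 0"
    and n: "n \<ge> 1" and E: "finite E" "spanning \<alpha> n \<epsilon> UNIV E"
  shows "h n x \<le> c ^ n * (\<Sum>y\<in>E. W n y)"
proof -
  let ?F = "{y\<in>Y. (\<alpha> ^^ n) y = x}"
  have "\<exists>y\<in>E. \<forall>i<n. dist ((\<alpha> ^^ i) z) ((\<alpha> ^^ i) y) < \<epsilon>" for z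
    using E(2) unfolding spanning_def dyn_dist_less_iff[OF n] by blast
  then obtain p where p: "\<And>z. p z \<in> E" "\<And>z i. i < n \<Longrightarrow> dist ((\<alpha> ^^ i) z) ((\<alpha> ^^ i) (p z)) < \<epsilon>"
    by metis
  have inj: "inj_on p ?F"
  proof (rule inj_onI)
    fix y z assume y: "y \<in> ?F" and z: "z \<in> ?F" and eq: "p y = p z"
    show "y = z"
    proof (rule core_orbit_separated[OF e])
      show "dist ((\<alpha> ^^ i) y) ((\<alpha> ^^ i) z) < 2 * \<epsilon>" if i: "i < n" for i
        using dist_triangle2[of "(\<alpha> ^^ i) y" "(\<alpha> ^^ i) z" "(\<alpha> ^^ i) (p y)"] p(2)[OF i, of y] p(2)[OF i, of z] eq
        by simp
    qed (use y z in auto)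
  qed
  have "h n x \<le> (\<Sum>y\<in>?F. c ^ n * W n (p y))"
    unfolding h_def by (intro sum_mono W_le[OF c(1)]) (auto intro: p(2))
  also have "\<dots> = c ^ n * (\<Sum>y\<in>p ` ?F. W n y)"
    by (simp add: sum.reindex[OF inj] sum_distrib_left)
  also have "\<dots> \<le> c ^ n * (\<Sum>y\<in>E. W n y)"
    using p(1) c(2) E(1) W_pos by (intro mult_left_mono sum_mono2) (auto intro: less_imp_le)
  finally show ?thesis .
qed

text \<open>A spanning set of \<open>Y\<close> at one time \<open>m\<close> controls all large times
  on \<open>X\<close>: it gives an \<open>m\<close>-step cover near \<open>Y\<close>, a finite net
  gives one-step covers elsewhere, and the damping makes the latter cheap before it is removed
  again.\<close>

lemma spanning_growth:
  assumes m: "m \<ge> 1" and \<epsilon>: "\<epsilon> > 0" and E: "finite E" "spanning \<alpha> m \<epsilon> Y E"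
    and c: "\<And>x y. dist x y < 2 * \<epsilon> \<Longrightarrow> a x \<le> c * a y" "c \<ge> 0"
    and s: "c ^ m * (\<Sum>y\<in>E. W m y) < s ^ m" "s > 0" "s < r"
  shows "\<exists>N. \<forall>n\<ge>N. \<exists>E'. finite E' \<and> spanning \<alpha> n (4 * \<epsilon>) UNIV E' \<and> (\<Sum>y\<in>E'. W n y) \<le> r ^ n"
proof -
  define Z where "Z = c ^ m * (\<Sum>y\<in>E. W m y)"
  define q where "q = s * (1 - Z / s ^ m)"
  have q: "q > 0" using s by (simp add: q_def Z_def)
  \<comment> \<open>Points within \<delta> of \<open>Y\<close> follow a point of \<open>Y\<close> up
    to \<epsilon> for \<open>m\<close> steps, so \<open>E\<close> shadows the whole neighbourhood
    \<open>U\<close> up to \<open>2 * \<epsilon>\<close>.\<close>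
  obtain \<delta> where \<delta>: "\<delta> > 0" "\<And>x y i. dist x y < \<delta> \<Longrightarrow> i < m \<Longrightarrow> dist ((\<alpha> ^^ i) x) ((\<alpha> ^^ i) y) < \<epsilon>"
    using uniform_orbit_continuity[OF cont \<epsilon>, of m] by blast
  define f where "f = (\<lambda>x. min 1 (infdist x Y / \<delta>))"
  define U where "U = {x. infdist x Y < \<delta>}"
  have f: "continuous_on UNIV f" "\<And>x. 0 \<le> f x" "\<And>x. x \<in> Y \<Longrightarrow> f x = 0" "\<And>x. x \<notin> U \<Longrightarrow> f x = 1"
    unfolding f_def U_def using \<delta>(1) by (auto intro!: continuous_intros divide_nonneg_pos infdist_nonneg)
  obtain M where M: "M > 0" "\<And>x. \<bar>a x\<bar> \<le> M"
    using continuous_on_compact_bounded[OF continuous_a] by blast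
  obtain K :: "'a set" where K: "finite K" "\<And>x. \<exists>y\<in>K. dist x y < \<epsilon>"
    using compact_metric_finite_net[OF \<epsilon>] by blast
  have "K \<noteq> {}" using K(2) by blast
  then have cardK: "real (card K) > 0" using K(1) by (simp add: card_gt_0_iff)
  \<comment> \<open>Off \<open>U\<close> the damped weight is at most \<open>M * exp (- t)\<close>;
    as \<open>t * exp (- t) \<le> 1\<close>, the sum over the net is then at most
    \<open>q\<close>.\<close>
  define t where "t = card K * M / q"
  have t: "t > 0" using cardK M q by (simp add: t_def)
  define v where "v = (\<lambda>x. a x * exp (- t * f x))"
  have v0: "0 \<le> v x" for x by (simp add: v_def less_imp_le[OF a_pos])
  have va: "v x \<le> a x" for x
    unfolding v_def using a_pos[of x] f(2)[of x] t by (intro mult_right_le_one_le) auto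
  \<comment> \<open>Cover sets of radius \<open>2 * \<epsilon>\<close> have mutual distances below
    \<open>4 * \<epsilon>\<close>, the radius in the conclusion.\<close>
  have ball: "dist y z < 4 * \<epsilon>" if "dist y x < 2 * \<epsilon>" "dist z x < 2 * \<epsilon>" for x y z :: 'a
    using dist_triangle2[of y z x] that by linarith
  have core: "weighted_cover \<alpha> v (4 * \<epsilon>) U m Z"
  proof (rule weighted_coverI[where I = E and c = "\<lambda>y. c ^ m * W m y"
        and V = "\<lambda>y. {x. \<forall>i<m. dist ((\<alpha> ^^ i) x) ((\<alpha> ^^ i) y) < 2 * \<epsilon>}"])
    show "U \<subseteq> (\<Union>y\<in>E. {x. \<forall>i<m. dist ((\<alpha> ^^ i) x) ((\<alpha> ^^ i) y) < 2 * \<epsilon>})"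
    proof
      fix x assume "x \<in> U"
      then have "(INF z\<in>Y. dist x z) < \<delta>"
        using essential_points_nonempty[OF cont] by (simp add: U_def infdist_notempty)
      then obtain z where z: "z \<in> Y" "dist x z < \<delta>"
        using essential_points_nonempty[OF cont] by (subst (asm) cINF_less_iff) auto
      obtain y where y: "y \<in> E" "\<And>i. i < m \<Longrightarrow> dist ((\<alpha> ^^ i) z) ((\<alpha> ^^ i) y) < \<epsilon>"
        using E(2) z(1) unfolding spanning_def dyn_dist_less_iff[OF m] by blast
      have "dist ((\<alpha> ^^ i) x) ((\<alpha> ^^ i) y) < 2 * \<epsilon>" if i: "i < m" for i
        using dist_triangle[of "(\<alpha> ^^ i) x" "(\<alpha> ^^ i) y" "(\<alpha> ^^ i) z"] \<delta>(2)[OF z(2) i] y(2)[OF i] by linarith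
      then show "x \<in> (\<Union>y\<in>E. {x. \<forall>i<m. dist ((\<alpha> ^^ i) x) ((\<alpha> ^^ i) y) < 2 * \<epsilon>})" using y(1) by blast
    qed
    show "(\<Prod>i<m. v ((\<alpha> ^^ i) x)) \<le> c ^ m * W m y"
      if "x \<in> {x. \<forall>i<m. dist ((\<alpha> ^^ i) x) ((\<alpha> ^^ i) y) < 2 * \<epsilon>}" for x y
    proof -
      have "(\<Prod>i<m. v ((\<alpha> ^^ i) x)) \<le> W m x"
        unfolding W_def by (intro prod_mono conjI v0 va)
      also have "\<dots> \<le> c ^ m * W m y" using that by (intro W_le[OF c(1)]) auto
      finally show ?thesis .
    qed
    show "(\<Sum>y\<in>E. c ^ m * W m y) \<le> Z" by (simp add: Z_def sum_distrib_left)
  qed (use E(1) c(2) W_pos[THEN less_imp_le] ball in auto)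
  have rest: "weighted_cover \<alpha> v (4 * \<epsilon>) (- U) 1 (s * (1 - Z / s ^ m))"
  proof (rule weighted_coverI[where I = K and c = "\<lambda>_. M * exp (- t)" and V = "\<lambda>y. {x\<in>-U. dist x y < 2 * \<epsilon>}"])
    have "\<exists>y\<in>K. dist x y < 2 * \<epsilon>" for x using K(2)[of x] \<epsilon> by force
    then show "- U \<subseteq> (\<Union>y\<in>K. {x\<in>-U. dist x y < 2 * \<epsilon>})" by blast
    show "(\<Prod>k<1. v ((\<alpha> ^^ k) x)) \<le> M * exp (- t)" if "x \<in> {x\<in>-U. dist x y < 2 * \<epsilon>}" for x y
      using that M(2)[of x] f(4)[of x] by (simp add: v_def)
    have "t \<le> exp t" using exp_ge_add_one_self[of t] by linarith
    then have "t * exp (- t) \<le> 1" by (simp add: exp_minus field_simps)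
    then have "q * (t * exp (- t)) \<le> q * 1" using q by (intro mult_left_mono) auto
    moreover have "q * (t * exp (- t)) = card K * (M * exp (- t))" using q by (simp add: t_def)
    ultimately show "(\<Sum>y\<in>K. M * exp (- t)) \<le> s * (1 - Z / s ^ m)"
      unfolding q_def[symmetric] by simp
  qed (use K(1) M(1) ball in auto)
  have all: "weighted_cover \<alpha> v (4 * \<epsilon>) UNIV 1 (card K * M)"
  proof (rule weighted_coverI[where I = K and c = "\<lambda>_. M" and V = "\<lambda>y. {x. dist x y < 2 * \<epsilon>}"])
    have "\<exists>y\<in>K. dist x y < 2 * \<epsilon>" for x using K(2)[of x] \<epsilon> by force
    then show "UNIV \<subseteq> (\<Union>y\<in>K. {x. dist x y < 2 * \<epsilon>})" by blast
    show "(\<Prod>k<1. v ((\<alpha> ^^ k) x)) \<le> M" for x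
      using va[of x] M(2)[of x] by simp
  qed (use K(1) M(1) ball in auto)
  obtain C where C: "C > 0" "\<And>n. weighted_cover \<alpha> v (4 * \<epsilon>) UNIV n (C * s ^ n)"
    using weighted_cover_growth[OF core rest all _ v0 m s(2)] cardK M(1) by auto
  obtain N where N: "\<And>n x. n \<ge> N \<Longrightarrow> C * s ^ n \<le> r ^ n * (\<Prod>i<n. exp (- t * f ((\<alpha> ^^ i) x)))"
    using damped_product_lower[OF cont f(1,3) t s(2,3) C(1)] by blast
  have "\<exists>E'. finite E' \<and> spanning \<alpha> n (4 * \<epsilon>) UNIV E' \<and> (\<Sum>y\<in>E'. W n y) \<le> r ^ n" if n: "n \<ge> max 1 N" for n
  proof -
    define k where "k = r ^ n / (C * s ^ n)"
    have k0: "k \<ge> 0" using s C by (simp add: k_def)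
    have "W n x \<le> k * (\<Prod>i<n. v ((\<alpha> ^^ i) x))" for x
    proof -
      have "1 \<le> k * (\<Prod>i<n. exp (- t * f ((\<alpha> ^^ i) x)))"
        using N[of n x] n s C by (simp add: k_def field_simps)
      then have "W n x * 1 \<le> W n x * (k * (\<Prod>i<n. exp (- t * f ((\<alpha> ^^ i) x))))"
        using W_pos[of n x] by (intro mult_left_mono) auto
      then show ?thesis by (simp add: v_def W_def prod.distrib mult.left_commute)
    qed
    from weighted_cover_spanning[OF C(2) _ k0 this] n W_pos[THEN less_imp_le]
    show ?thesis using s C by (simp add: k_def)
  qed
  then show ?thesis by blast
qed

end

section \<open>Spectral potential and pressure\<close>

context cocycle_transfer
begin

section \<open>Operator norms of the iterates\<close>

context
  fixes Wt :: "('a \<Rightarrow>\<^sub>C complex) \<Rightarrow> ('a \<Rightarrow>\<^sub>C complex)" and \<psi>' :: "'a \<Rightarrow>\<^sub>C real"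
  assumes \<psi>': "\<psi> = apply_bcontfun \<psi>'"
  defines "Wt \<equiv> weighted_operator A \<psi>'"
begin

lemma Wt_apply: "apply_bcontfun (Wt f) x = (LINT y|\<nu> x. of_real (exp (\<psi> y)) * apply_bcontfun f y)"
proof -
  have "continuous_on UNIV (\<lambda>y. of_real (exp (\<psi> y)) * apply_bcontfun f y)"
    by (intro continuous_intros \<psi> continuous_on_apply_bcontfun)
  then show ?thesis
    by (simp add: integral_nu) (simp add: Wt_def weighted_operator_def T_def \<psi>')
qed

lemma norm_Wt_pow_le:
  assumes g: "continuous_on UNIV g" and fg: "\<And>y. norm (apply_bcontfun f y) \<le> g y"
  shows "norm (apply_bcontfun ((Wt ^^ n) f) x) \<le> (B ^^ n) g x"
  using g fg
proof (induction n arbitrary: x)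
  case (Suc n)
  let ?f = "(Wt ^^ n) f"
  have c: "continuous_on UNIV ((B ^^ n) g)" by (intro continuous_Op_pow continuous_weight Suc.prems)
  have "norm (apply_bcontfun (Wt ?f) x) \<le> (LINT y|\<nu> x. norm (of_real (exp (\<psi> y)) * apply_bcontfun ?f y))"
    unfolding Wt_apply by (rule integral_norm_bound)
  also have "\<dots> \<le> (LINT y|\<nu> x. exp (\<psi> y) * (B ^^ n) g y)"
  proof (intro integral_mono integrable_nu)
    show "norm (of_real (exp (\<psi> y)) * apply_bcontfun ?f y) \<le> exp (\<psi> y) * (B ^^ n) g y" for y
      using Suc by (simp add: norm_mult)
  qed (intro continuous_intros \<psi> c continuous_on_apply_bcontfun)+
  finally show ?case by (simp only: funpow.simps o_def Op_def[where f = "(B ^^ n) g"])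
qed simp

lemma Wt_pow_of_real:
  assumes g: "continuous_on UNIV g" and f: "\<And>y. apply_bcontfun f y = of_real (g y)"
  shows "apply_bcontfun ((Wt ^^ n) f) x = of_real ((B ^^ n) g x)"
proof (induction n arbitrary: x)
  case (Suc n)
  then have "apply_bcontfun (Wt ((Wt ^^ n) f)) x = (LINT y|\<nu> x. complex_of_real (exp (\<psi> y) * (B ^^ n) g y))"
    by (simp add: Wt_apply)
  also have "\<dots> = of_real (LINT y|\<nu> x. exp (\<psi> y) * (B ^^ n) g y)" by (rule integral_complex_of_real)
  finally show ?case by (simp only: funpow.simps o_def Op_def[where f = "(B ^^ n) g"])
qed (simp add: f)

lemma onorm_Wt_pow_le:
  assumes "\<And>x. (B ^^ n) (\<lambda>_. 1) x \<le> c"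
  shows "onorm (Wt ^^ n) \<le> c"
proof (rule onorm_bound)
  have "0 \<le> (B ^^ n) (\<lambda>_. 1) undefined"
    by (intro Op_pow_nonneg continuous_weight continuous_on_const) auto
  then show "0 \<le> c" using assms order_trans by blast
  fix f
  show "norm ((Wt ^^ n) f) \<le> c * norm f"
  proof (rule norm_bound)
    fix x
    have "norm (apply_bcontfun ((Wt ^^ n) f) x) \<le> (B ^^ n) (\<lambda>_. norm f * 1) x"
      by (rule norm_Wt_pow_le) (auto simp: norm_bounded)
    also have "\<dots> = norm f * (B ^^ n) (\<lambda>_. 1) x" by (simp only: Op_pow_scale)
    also have "\<dots> \<le> norm f * c" by (intro mult_left_mono assms) simp
    finally show "norm (apply_bcontfun ((Wt ^^ n) f) x) \<le> c * norm f" by (simp add: mult.commute)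
  qed
qed

text \<open>The constant \<open>1\<close> has norm \<open>1\<close> and serves as test function. As
  \<open>onorm\<close> is a supremum of reals, the quotients must first be shown bounded.\<close>

lemma onorm_Wt_pow_ge: "(B ^^ n) (\<lambda>_. 1) x \<le> onorm (Wt ^^ n)"
proof -
  let ?one = "const_bcontfun 1 :: 'a \<Rightarrow>\<^sub>C complex"
  obtain c where c: "\<And>x. \<bar>(B ^^ n) (\<lambda>_. 1) x\<bar> \<le> c"
    using continuous_on_compact_bounded[OF continuous_Op_pow[OF continuous_weight continuous_on_const]] by blast
  have "norm ((Wt ^^ n) f) / norm f \<le> max c 0" for f
  proof -
    have "norm ((Wt ^^ n) f) \<le> max c 0 * norm f"
    proof (rule norm_bound)
      fix x
      have "norm (apply_bcontfun ((Wt ^^ n) f) x) \<le> (B ^^ n) (\<lambda>_. norm f * 1) x"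
        by (rule norm_Wt_pow_le) (auto simp: norm_bounded)
      also have "\<dots> = norm f * (B ^^ n) (\<lambda>_. 1) x" by (simp only: Op_pow_scale)
      also have "\<dots> \<le> norm f * max c 0" using c[of x] by (intro mult_left_mono) auto
      finally show "norm (apply_bcontfun ((Wt ^^ n) f) x) \<le> max c 0 * norm f" by (simp add: mult.commute)
    qed
    then show ?thesis by (cases "f = 0") (auto simp: field_simps)
  qed
  then have bdd: "bdd_above (range (\<lambda>f. norm ((Wt ^^ n) f) / norm f))" by (intro bdd_aboveI2)
  have one: "norm ?one = 1"
  proof (rule antisym)
    show "norm ?one \<le> 1" by (rule norm_bound) simp
    show "1 \<le> norm ?one" using norm_bounded[of ?one undefined] by simp
  qed
  have "(B ^^ n) (\<lambda>_. 1) x \<le> norm (apply_bcontfun ((Wt ^^ n) ?one) x)"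
    by (subst Wt_pow_of_real[where g = "\<lambda>_. 1"]) auto
  also have "\<dots> \<le> norm ((Wt ^^ n) ?one)" by (rule norm_bounded)
  also have "\<dots> = norm ((Wt ^^ n) ?one) / norm ?one" by (simp add: one)
  also have "\<dots> \<le> onorm (Wt ^^ n)" unfolding onorm_def by (intro cSUP_upper bdd) simp
  finally show ?thesis .
qed

end

end

section \<open>Exponential rates and their limits\<close>

lemma multiplicative_uniform_continuity:
  fixes g :: "'a::compact_metric_space \<Rightarrow> real"
  assumes g: "continuous_on UNIV g" "\<And>x. g x > 0" and c: "c > 1"
  shows "\<exists>\<delta>>0. \<forall>x y. dist x y < \<delta> \<longrightarrow> g x \<le> c * g y"
proof -
  have "uniformly_continuous_on UNIV (\<lambda>x. ln (g x))"
    by (intro compact_uniformly_continuous compact_carrier continuous_intros g) (use g in \<open>auto simp: less_imp_neq[symmetric]\<close>)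
  then obtain \<delta> where \<delta>: "\<delta> > 0" "\<And>x y. dist x y < \<delta> \<Longrightarrow> dist (ln (g x)) (ln (g y)) < ln c"
    using c ln_gt_zero[of c] unfolding uniformly_continuous_on_def by (metis UNIV_I dist_commute)
  have "g x \<le> c * g y" if "dist x y < \<delta>" for x y
  proof -
    have "ln (g x) \<le> ln c + ln (g y)" using \<delta>(2)[OF that] by (simp add: dist_real_def)
    also have "\<dots> = ln (c * g y)" using c g(2)[of y] by (simp add: ln_mult)
    finally show ?thesis using c g(2) by (simp add: ln_le_cancel_iff)
  qed
  then show ?thesis using \<delta>(1) by blast
qed

text \<open>A form of Fekete's lemma with the limit as infimum of the roots; \<open>growth\<close>
  takes the place of submultiplicativity, and \<kappa> keeps the infimum positive.\<close>

lemma root_limit_of_growth: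
  fixes b :: "nat \<Rightarrow> real"
  assumes b: "\<And>n. b n \<ge> \<kappa> ^ n" and \<kappa>: "\<kappa> > 0"
    and growth: "\<And>m r. m \<ge> 1 \<Longrightarrow> r > 0 \<Longrightarrow> b m < r ^ m \<Longrightarrow> \<forall>\<^sub>F n in sequentially. b n \<le> r ^ n"
  obtains L where "L > 0" "(\<lambda>n. b n powr (1 / real n)) \<longlonglongrightarrow> L"
proof -
  have b0: "b n > 0" for n using b[of n] \<kappa> zero_less_power less_le_trans by blast
  have low: "\<kappa> \<le> b n powr (1 / real n)" if "n \<ge> 1" for n
    using powr_inverse_less_iff[OF that less_imp_le[OF b0] \<kappa>] b[of n] by (meson not_le)
  define L where "L = (INF n\<in>{1..}. b n powr (1 / real n))"
  have bdd: "bdd_below ((\<lambda>n. b n powr (1 / real n)) ` {1..})"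
    using low by (intro bdd_belowI2[of _ \<kappa>]) auto
  have "\<kappa> \<le> L" unfolding L_def using low by (intro cINF_greatest) auto
  then have L: "L > 0" using \<kappa> by linarith
  have Lle: "L \<le> b n powr (1 / real n)" if "n \<ge> 1" for n
    unfolding L_def using that by (intro cINF_lower bdd) auto
  have "(\<lambda>n. b n powr (1 / real n)) \<longlonglongrightarrow> L"
  proof (rule order_tendstoI)
    fix y assume y: "y < L"
    show "\<forall>\<^sub>F n in sequentially. y < b n powr (1 / real n)"
      using eventually_ge_at_top[of 1] by eventually_elim (use Lle y less_le_trans in blast)
  next
    fix y assume y: "L < y"
    then obtain r where r: "L < r" "r < y" using dense by blast
    then obtain m where m: "m \<ge> 1" "b m powr (1 / real m) < r"
      unfolding L_def by (subst (asm) cINF_less_iff[OF _ bdd]) auto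
    have "b m < r ^ m"
      using powr_inverse_less_iff[OF m(1) less_imp_le[OF b0]] m(2) r L by auto
    then have "\<forall>\<^sub>F n in sequentially. b n \<le> r ^ n" using m(1) r L by (intro growth) auto
    then show "\<forall>\<^sub>F n in sequentially. b n powr (1 / real n) < y"
      using eventually_ge_at_top[of 1]
    proof eventually_elim
      case (elim n)
      then have "b n powr (1 / real n) \<le> r"
        using powr_inverse_le_iff[of n "b n" r] less_imp_le[OF b0] r L by auto
      then show ?case using r by linarith
    qed
  qed
  then show ?thesis using L that by blast
qed

lemma lim_ext_ln:
  assumes L: "L > 0" "(\<lambda>n. b n powr (1 / real n)) \<longlonglongrightarrow> L" and b: "\<And>n. b n > 0"
  shows "lim (\<lambda>n. ereal (1 / real n) * ext_ln (ereal (b n))) = ereal (ln L)"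
proof (rule limI)
  have "(\<lambda>n. ln (b n powr (1 / real n))) \<longlonglongrightarrow> ln L"
    by (rule tendsto_ln[OF L(2)]) (use L in simp)
  then have "(\<lambda>n. ereal (ln (b n powr (1 / real n)))) \<longlonglongrightarrow> ereal (ln L)" by simp
  \<comment> \<open>At \<open>n = 0\<close> division by zero makes the exponent \<open>0\<close>,
    and both sides are \<open>0\<close>.\<close>
  moreover have "ereal (ln (b n powr (1 / real n))) = ereal (1 / real n) * ext_ln (ereal (b n))" for n
    using b[of n] by (simp add: ext_ln_def ln_powr)
  ultimately show "(\<lambda>n. ereal (1 / real n) * ext_ln (ereal (b n))) \<longlonglongrightarrow> ereal (ln L)" by (simp only:)
qed

lemma tendsto_ereal_of_ratio_bounds:
  fixes g :: "'a \<Rightarrow> ereal"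
  assumes L: "L > 0"
    and bounds: "\<And>c. c > 1 \<Longrightarrow> \<forall>\<^sub>F x in F. ereal (L / c) \<le> g x \<and> g x \<le> ereal (c * L)"
  shows "(g \<longlongrightarrow> ereal L) F"
proof (rule order_tendstoI)
  fix y assume "y < ereal L"
  \<comment> \<open>The bound \<open>y\<close> may be negative or infinite; the maximum makes
    \<open>p\<close> positive, so that \<open>L / p\<close> is an admissible ratio.\<close>
  then have "max y 0 < ereal L" using L by simp
  then obtain p where p: "max y 0 < ereal p" "ereal p < ereal L" using ereal_dense2 by blast
  then have p': "0 < p" "p < L" "y < ereal p" by auto
  have "\<forall>\<^sub>F x in F. ereal (L / (L / p)) \<le> g x \<and> g x \<le> ereal (L / p * L)"
    using p' by (intro bounds) simp
  then show "\<forall>\<^sub>F x in F. y < g x"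
    by eventually_elim (use p' L in \<open>auto intro: less_le_trans\<close>)
next
  fix y assume "ereal L < y"
  then obtain p where p: "ereal L < ereal p" "ereal p < y" using ereal_dense2 by blast
  have "\<forall>\<^sub>F x in F. ereal (L / (p / L)) \<le> g x \<and> g x \<le> ereal (p / L * L)"
    using p L by (intro bounds) simp
  then show "\<forall>\<^sub>F x in F. g x < y"
    by eventually_elim (use p L in \<open>auto intro: le_less_trans\<close>)
qed

theorem theorem22:
  fixes \<alpha> :: "'a::compact_metric_space \<Rightarrow> 'a"
    and A :: "('a \<Rightarrow>\<^sub>C complex) \<Rightarrow> ('a \<Rightarrow>\<^sub>C complex)"
    and \<rho> :: "'a \<Rightarrow> real"
    and \<psi> :: "'a \<Rightarrow>\<^sub>C real"
  assumes "continuous_on UNIV \<alpha>"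
    and "local_homeomorphism (essential_points \<alpha>) (essential_points \<alpha>) \<alpha>"
    and "transfer_operator \<alpha> A"
    and "compatible_on (essential_points \<alpha>) A"
    and "property_star \<alpha>"
    and "\<forall>y\<in>essential_points \<alpha>. cocycle \<alpha> A y > 0"
    and "continuous_on UNIV \<rho>"
    and "\<forall>x. \<rho> x > 0"
    and "\<forall>y\<in>essential_points \<alpha>. \<rho> y = cocycle \<alpha> A y"
  shows "spectral_potential A \<psi> = top_pressure \<alpha> (\<lambda>x. apply_bcontfun \<psi> x + ln (\<rho> x))"
proof -
  interpret cocycle_transfer \<alpha> A "apply_bcontfun \<psi>" \<rho>
    using assms by unfold_locales (auto intro: continuous_on_apply_bcontfun)
  define b where "b = (\<lambda>n. onorm (weighted_operator A \<psi> ^^ n))"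
  have b_le: "b n \<le> c" if "\<And>x. (B ^^ n) (\<lambda>_. 1) x \<le> c" for n c
    using onorm_Wt_pow_le[OF refl that] by (simp add: b_def)
  have b_ge: "(B ^^ n) (\<lambda>_. 1) x \<le> b n" for n x
    using onorm_Wt_pow_ge[OF refl] by (simp add: b_def)
  have h_b: "h n x \<le> b n" for n x using h_le b_ge order_trans by blast

  \<comment> \<open>The weight is bounded away from \<open>0\<close>, so the norms have an
    exponential lower bound and their rate is positive.\<close>
  have "continuous_on UNIV (\<lambda>x. 1 / a x)"
    using a_pos by (intro continuous_intros continuous_a) (auto simp: less_imp_neq[symmetric])
  then obtain M where M: "M > 0" "\<And>x. \<bar>1 / a x\<bar> \<le> M" using continuous_on_compact_bounded by blast
  have a_ge: "1 / M \<le> a x" for x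
    using M(2)[of x] a_pos[of x] M(1) by (simp add: field_simps)
  have b_lower: "(1 / M) ^ n \<le> b n" for n
  proof -
    obtain y where y: "y \<in> Y" using essential_points_nonempty[OF cont] by blast
    have "(\<Prod>i<n. 1 / M) \<le> W n y"
      unfolding W_def using M(1) by (intro prod_mono conjI a_ge) simp
    also have "\<dots> \<le> b n" using operator_lower[OF y] b_ge order_trans by blast
    finally show ?thesis by simp
  qed
  have b_growth: "\<forall>\<^sub>F n in sequentially. b n \<le> r ^ n"
    if m: "m \<ge> 1" and Z: "\<And>x. h m x \<le> Z" and r: "r > 0" "Z < r ^ m" for m r Z
  proof -
    obtain N where "\<And>n x. n \<ge> N \<Longrightarrow> (B ^^ n) (\<lambda>_. 1) x \<le> r ^ n"
      using operator_growth_le_core[OF m Z r] by blast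
    then have "b n \<le> r ^ n" if "n \<ge> N" for n using that by (intro b_le) auto
    then show ?thesis by (auto simp: eventually_sequentially)
  qed
  \<comment> \<open>Since \<open>h m\<close> is bounded by \<open>b m\<close>,
    \<open>b_growth\<close> with \<open>Z = b m\<close> is exactly the hypothesis
    \<open>growth\<close>.\<close>
  obtain L where L: "L > 0" "(\<lambda>n. b n powr (1 / real n)) \<longlonglongrightarrow> L"
    by (rule root_limit_of_growth[of "1 / M" b]) (use b_lower M(1) b_growth[OF _ h_b] in auto)
  have b_pos: "b n > 0" for n using b_lower[of n] M(1) by (meson less_le_trans zero_less_divide_1_iff zero_less_power)

  have W_eq: "(\<Prod>i<n. exp (apply_bcontfun \<psi> ((\<alpha> ^^ i) y) + ln (\<rho> ((\<alpha> ^^ i) y)))) = W n y" for n y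
    using \<rho>(2) by (simp add: W_def a_def exp_add)
  define S where "S = (\<lambda>n \<epsilon>. INF E\<in>{E. finite E \<and> spanning \<alpha> n \<epsilon> UNIV E}. ereal ((\<Sum>y\<in>E. W n y) powr (1 / real n)))"
  have sum0: "0 \<le> (\<Sum>y\<in>E. W n y)" for E n using W_pos by (intro sum_nonneg less_imp_le)

  \<comment> \<open>If a spanning sum at a single time \<open>n\<close> had its root below
    \<open>p < L / c\<close>, then \<open>h n\<close> would be below \<open>(c * p) ^ n\<close>, and
    the norms would grow at a rate of at most \<open>c * p < L\<close>.\<close>
  have lower: "ereal (L / c) \<le> S n \<epsilon>"
    if e: "\<And>x y. x \<in> Y \<Longrightarrow> y \<in> Y \<Longrightarrow> \<alpha> x = \<alpha> y \<Longrightarrow> dist x y < 2 * \<epsilon> \<Longrightarrow> x = y"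
      and c: "\<And>x y. dist x y < \<epsilon> \<Longrightarrow> a x \<le> c * a y" "c > 0" and n: "n \<ge> 1" for c \<epsilon> n
    unfolding S_def
  proof (rule INF_greatest)
    fix E assume "E \<in> {E. finite E \<and> spanning \<alpha> n \<epsilon> UNIV E}"
    then have E: "finite E" "spanning \<alpha> n \<epsilon> UNIV E" by auto
    let ?s = "(\<Sum>y\<in>E. W n y) powr (1 / real n)"
    have "L / c \<le> ?s"
    proof (rule ccontr)
      assume "\<not> L / c \<le> ?s"
      then obtain p where p: "?s < p" "p < L / c" using dense[of ?s "L / c"] by auto
      have p0: "p > 0" using p(1) powr_ge_zero[of "\<Sum>y\<in>E. W n y" "1 / real n"] by linarith
      have "(\<Sum>y\<in>E. W n y) < p ^ n" using powr_inverse_less_iff[OF n sum0 p0] p(1) by simp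
      then have "c ^ n * (\<Sum>y\<in>E. W n y) < (c * p) ^ n" using c(2) by (simp add: power_mult_distrib)
      then have "\<forall>\<^sub>F k in sequentially. b k \<le> (c * p) ^ k"
        using c(2) p0 by (intro b_growth[OF n h_le_spanning_sum[OF e c(1) _ n E]]) auto
      then have "\<forall>\<^sub>F k in sequentially. b k powr (1 / real k) \<le> c * p"
        using eventually_ge_at_top[of 1]
        by eventually_elim (use powr_inverse_le_iff b_pos c(2) p0 in \<open>auto simp: less_imp_le\<close>)
      then have "L \<le> c * p" by (intro tendsto_upperbound[OF L(2)]) auto
      then show False using p(2) c(2) by (simp add: field_simps)
    qed
    then show "ereal (L / c) \<le> ereal ?s" by simp
  qed

  obtain F where F: "\<And>n \<epsilon>. n \<ge> 1 \<Longrightarrow> \<epsilon> > 0 \<Longrightarrow> finite (F n \<epsilon>) \<and> F n \<epsilon> \<subseteq> Y \<and>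
      spanning \<alpha> n \<epsilon> Y ((\<alpha> ^^ n) -` F n \<epsilon> \<inter> Y)"
    and Flim: "\<And>\<epsilon>. \<epsilon> > 0 \<Longrightarrow> (\<lambda>n. real (card (F n \<epsilon>)) powr (1 / real n)) \<longlonglongrightarrow> 1"
    using assms(5) unfolding property_star_def by blast

  \<comment> \<open>The preimage of \<open>F m \<epsilon>\<close> in \<open>Y\<close> splits into
    fibres, each with weight sum at most \<open>b m\<close>. As the cardinalities grow
    subexponentially, some \<open>m\<close> meets the hypothesis of
    \<open>spanning_growth\<close>.\<close>
  have upper: "\<forall>\<^sub>F n in sequentially. S n (4 * \<epsilon>) \<le> ereal r"
    if e: "\<epsilon> > 0" and c: "\<And>x y. dist x y < 2 * \<epsilon> \<Longrightarrow> a x \<le> c * a y" "c > 0" and r: "c * L < r" for c \<epsilon> r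
  proof -
    obtain s where s: "c * L < s" "s < r" using dense[OF r] by blast
    have s0: "s > 0" using s(1) c(2) L(1) by (meson less_trans mult_pos_pos)
    have "(\<lambda>n. real (card (F n \<epsilon>)) powr (1 / real n) * b n powr (1 / real n)) \<longlonglongrightarrow> 1 * L"
      by (intro tendsto_mult Flim e L)
    then have "\<forall>\<^sub>F n in sequentially. real (card (F n \<epsilon>)) powr (1 / real n) * b n powr (1 / real n) < s / c"
      by (rule order_tendstoD) (use s c in \<open>simp add: field_simps\<close>)
    then have "\<forall>\<^sub>F n in sequentially. n \<ge> 1 \<and> real (card (F n \<epsilon>)) powr (1 / real n) * b n powr (1 / real n) < s / c"
      using eventually_ge_at_top[of 1] by eventually_elim simp
    then obtain m where m: "m \<ge> 1" "real (card (F m \<epsilon>)) powr (1 / real m) * b m powr (1 / real m) < s / c"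
      by (auto simp: eventually_sequentially)
    have "(card (F m \<epsilon>) * b m) powr (1 / real m) < s / c"
      using m(2) b_pos[of m] by (simp add: powr_mult)
    then have "card (F m \<epsilon>) * b m < (s / c) ^ m"
      using powr_inverse_less_iff[OF m(1), of "card (F m \<epsilon>) * b m" "s / c"] b_pos[of m] s0 c(2)
      by (simp add: less_imp_le)
    then have small: "c ^ m * (card (F m \<epsilon>) * b m) < s ^ m"
      using c(2) by (simp add: power_divide field_simps)
    let ?E = "(\<alpha> ^^ m) -` F m \<epsilon> \<inter> Y"
    note Fm = F[OF m(1) e]
    have Eeq: "?E = (\<Union>x\<in>F m \<epsilon>. {y\<in>Y. (\<alpha> ^^ m) y = x})" by auto
    have Efin: "finite ?E" unfolding Eeq using Fm finite_fibre_pow by blast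
    have "(\<Sum>y\<in>?E. W m y) = (\<Sum>x\<in>F m \<epsilon>. h m x)"
      unfolding Eeq h_def using Fm by (intro sum.UNION_disjoint) (auto intro: finite_fibre_pow)
    also have "\<dots> \<le> (\<Sum>x\<in>F m \<epsilon>. b m)" by (intro sum_mono h_b)
    finally have "c ^ m * (\<Sum>y\<in>?E. W m y) \<le> c ^ m * (card (F m \<epsilon>) * b m)"
      using c(2) by (intro mult_left_mono) auto
    then have "c ^ m * (\<Sum>y\<in>?E. W m y) < s ^ m" using small by linarith
    then obtain N where N: "\<And>n. n \<ge> N \<Longrightarrow> \<exists>E'. finite E' \<and> spanning \<alpha> n (4 * \<epsilon>) UNIV E' \<and> (\<Sum>y\<in>E'. W n y) \<le> r ^ n"
      using spanning_growth[OF m(1) e Efin _ c(1) _ _ s0 s(2)] Fm c(2) by (meson less_imp_le)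
    have "S n (4 * \<epsilon>) \<le> ereal r" if n: "n \<ge> max 1 N" for n
    proof -
      obtain E' where E': "finite E'" "spanning \<alpha> n (4 * \<epsilon>) UNIV E'" "(\<Sum>y\<in>E'. W n y) \<le> r ^ n"
        using N[of n] n by auto
      then have "(\<Sum>y\<in>E'. W n y) powr (1 / real n) \<le> r"
        using powr_inverse_le_iff[of n "\<Sum>y\<in>E'. W n y" r] sum0 n s0 s(2) by simp
      then show ?thesis unfolding S_def using E' by (intro INF_lower2[of E']) auto
    qed
    then show ?thesis unfolding eventually_sequentially by blast
  qed

  have "((\<lambda>\<epsilon>. limsup (\<lambda>n. S n \<epsilon>)) \<longlongrightarrow> ereal L) (at_right 0)"
  proof (rule tendsto_ereal_of_ratio_bounds[OF L(1)])
    fix c :: real assume c: "c > 1"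
    \<comment> \<open>\<open>upper\<close> needs a strict gap, here
      \<open>c' * L < c * L\<close>.\<close>
    define c' where "c' = (1 + c) / 2"
    have c': "1 < c'" "c' < c" using c by (auto simp: c'_def)
    obtain e where e: "e > 0" "\<And>x y. x \<in> Y \<Longrightarrow> y \<in> Y \<Longrightarrow> \<alpha> x = \<alpha> y \<Longrightarrow> dist x y < e \<Longrightarrow> x = y"
      using fibres_separated by blast
    obtain \<delta> where \<delta>: "\<delta> > 0" "\<And>x y. dist x y < \<delta> \<Longrightarrow> a x \<le> c' * a y"
      using multiplicative_uniform_continuity[OF continuous_a a_pos c'(1)] by blast
    \<comment> \<open>\<open>lower\<close> compares points within \<open>2 * \<epsilon>\<close>,
      hence the half of \<open>e\<close>. \<open>upper\<close> is used with
      \<open>\<epsilon> / 4\<close>, so it only needs \<delta> beyond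
      \<open>\<epsilon> / 2\<close>.\<close>
    define d where "d = min (e / 2) \<delta>"
    have "d > 0" using e \<delta> by (simp add: d_def)
    then have "\<forall>\<^sub>F \<epsilon> in at_right 0. 0 < \<epsilon> \<and> \<epsilon> < d"
      by (auto simp: eventually_at_right_field)
    then show "\<forall>\<^sub>F \<epsilon> in at_right 0. ereal (L / c) \<le> limsup (\<lambda>n. S n \<epsilon>) \<and> limsup (\<lambda>n. S n \<epsilon>) \<le> ereal (c * L)"
    proof eventually_elim
      case (elim \<epsilon>)
      have "ereal (L / c') \<le> S n \<epsilon>" if "n \<ge> 1" for n
        by (rule lower[OF e(2) \<delta>(2)]) (use elim c' that in \<open>auto simp: d_def\<close>)
      then have "\<forall>\<^sub>F n in sequentially. ereal (L / c') \<le> S n \<epsilon>"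
        by (auto simp: eventually_sequentially)
      then have "ereal (L / c') \<le> limsup (\<lambda>n. S n \<epsilon>)" by (intro le_Limsup) auto
      moreover have "ereal (L / c) \<le> ereal (L / c')"
        using c' L(1) by (simp add: frac_le)
      moreover have "\<forall>\<^sub>F n in sequentially. S n (4 * (\<epsilon> / 4)) \<le> ereal (c * L)"
        by (rule upper[OF _ \<delta>(2)]) (use elim c' L(1) in \<open>auto simp: d_def\<close>)
      then have "limsup (\<lambda>n. S n \<epsilon>) \<le> ereal (c * L)" by (intro Limsup_bounded) simp
      ultimately show ?case by (meson order_trans)
    qed
  qed
  then have "Lim (at_right 0) (\<lambda>\<epsilon>. limsup (\<lambda>n. S n \<epsilon>)) = ereal L"
    by (intro tendsto_Lim) auto
  then have "top_pressure \<alpha> (\<lambda>x. apply_bcontfun \<psi> x + ln (\<rho> x)) = ereal (ln L)"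
    unfolding top_pressure_def W_eq S_def using L(1) by (simp add: ext_ln_def)
  moreover have "spectral_potential A \<psi> = ereal (ln L)"
    unfolding spectral_potential_def b_def[symmetric] using lim_ext_ln[OF L b_pos] by (simp add: b_def)
  ultimately show ?thesis by simp
qed

end
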